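(* Let $G$ be a finite simple graph such that $I_G$ has jump sequence $[k;2,a_2,\dots,a_{k-1}]$ with $k\ge 3$ (that is, $a_1=2$). Then $a_2\ge 5$.
   Context: Let $\Bbbk$ be a field of characteristic zero. For a finite simple graph $G=(V,E)$ on $n$ vertices with at least one edge, let $R=\Bbbk[x_1,\dots,x_n]$ have one variable per vertex, and let the edge ideal be $I_G=(x_ix_j:\{i,j\}\in E)$. Convention: $\beta_{i,j}=\beta_{i,j}(I_G)$ denotes the graded Betti number of the quotient $R/I_G$ in homological degree $i$ and internal degree $j$ (so $\beta_{1,2}$ is the number of edges of $G$), and $\mathrm{reg}(I_G)=\max\{j-i+1:\beta_{i,j}\ne 0\}$. If $\mathrm{reg}(I_G)=k+1$, the jump sequence of $I_G$ is $[k;a_1,\dots,a_{k-1}]$, where $a_r=\min\{i:\beta_{i,i+r+1}\neq 0\}-1$ for $1\le r\le k-1$. *)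

theory Defs
  imports "HOL-Library.Poly_Mapping" "Jordan_Normal_Form.Matrix_Kernel"
begin

section \<open>The polynomial ring on a finite set of vertices\<close>

text \<open>
  The polynomial ring with one variable for each element of the finite type \<open>'v\<close> and coefficients
  in \<open>'k\<close>: finitely supported coefficient functions on the exponent vectors.
\<close>

type_synonym ('v, 'k) mpoly = "('v \<Rightarrow>\<^sub>0 nat) \<Rightarrow>\<^sub>0 'k"

definition var :: "'v \<Rightarrow> ('v, 'k::comm_ring_1) mpoly" where
  "var i = Poly_Mapping.single (Poly_Mapping.single i 1) 1"

definition monom_degree :: "('v::finite \<Rightarrow>\<^sub>0 nat) \<Rightarrow> nat" where
  "monom_degree m = (\<Sum>v\<in>UNIV. Poly_Mapping.lookup m v)"

definition ideal_generated :: "'a::comm_ring_1 set \<Rightarrow> 'a set" where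
  "ideal_generated S = Modules.module.span (*) S"

lemma module_times: "Modules.module ((*) :: 'a::comm_ring_1 \<Rightarrow> 'a \<Rightarrow> 'a)"
  by unfold_locales (auto simp: algebra_simps)

definition irrelevant_ideal :: "('v, 'k::comm_ring_1) mpoly set" where
  "irrelevant_ideal = ideal_generated (range var)"

section \<open>Edge ideals\<close>

definition simple_graph :: "'v set set \<Rightarrow> bool" where
  "simple_graph E \<longleftrightarrow> (\<forall>e\<in>E. card e = 2)"

definition edge_ideal :: "'v set set \<Rightarrow> ('v, 'k::comm_ring_1) mpoly set" where
  "edge_ideal E = ideal_generated {var i * var j | i j. {i, j} \<in> E}"

section \<open>Minimal graded free resolutions and graded Betti numbers\<close>

text \<open>
  Write \<open>R\<close> for the polynomial ring. A graded free module of finite rank with a homogeneous basis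
  is given by the list of the degrees of its basis elements: \<open>ds\<close> stands for the direct sum of the
  twists \<open>R(-a)\<close>, with \<open>a\<close> running through \<open>ds\<close>. A map from the module of \<open>es\<close> to the module of
  \<open>ds\<close> is a matrix over \<open>R\<close> acting on column vectors; it is homogeneous of degree 0 iff
  its entry at \<open>(p, q)\<close> is homogeneous of degree \<open>es ! q - ds ! p\<close>, and in particular zero if
  that number is negative.
\<close>

definition graded_map ::
    "nat list \<Rightarrow> nat list \<Rightarrow> ('v::finite, 'k::comm_ring_1) mpoly mat \<Rightarrow> bool" where
  "graded_map es ds A \<longleftrightarrow>
     A \<in> carrier_mat (length ds) (length es) \<and>
     (\<forall>p<length ds. \<forall>q<length es. \<forall>m\<in>Poly_Mapping.keys (A $$ (p, q)).
        monom_degree m + ds ! p = es ! q)"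

definition mat_image :: "'a::comm_ring_1 mat \<Rightarrow> 'a vec set" where
  "mat_image A = (\<lambda>v. A *\<^sub>v v) ` carrier_vec (dim_col A)"

text \<open>
  A minimal graded free resolution of \<open>R/I\<close>, for a proper homogeneous ideal \<open>I\<close>. The module in
  homological degree \<open>i\<close> has basis degrees \<open>d i\<close>, and \<open>D i\<close> is the differential from homological
  degree \<open>i + 1\<close> to homological degree \<open>i\<close>. In homological degree 0 the module is \<open>R\<close> itself,
  with the projection to \<open>R/I\<close> as augmentation, so that exactness there says that the image of
  \<open>D 0\<close> is \<open>I\<close>. Minimality says that all entries of the differentials lie in the ideal generated
  by the variables.
\<close>

definition minimal_graded_free_resolution ::
    "('v::finite, 'k::comm_ring_1) mpoly set \<Rightarrow> (nat \<Rightarrow> nat list) \<Rightarrow>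
     (nat \<Rightarrow> ('v, 'k) mpoly mat) \<Rightarrow> bool" where
  "minimal_graded_free_resolution I d D \<longleftrightarrow>
     d 0 = [0] \<and>
     (\<forall>i. graded_map (d (Suc i)) (d i) (D i)) \<and>
     (\<lambda>v. v $ 0) ` mat_image (D 0) = I \<and>
     (\<forall>i. mat_kernel (D i) = mat_image (D (Suc i))) \<and>
     (\<forall>i. elements_mat (D i) \<subseteq> irrelevant_ideal)"

text \<open>
  \<open>graded_betti_numbers I \<beta>\<close> says that \<open>\<beta> i j\<close> is the graded Betti number of the quotient \<open>R/I\<close>
  (not of \<open>I\<close>) in homological degree \<open>i\<close> and internal degree \<open>j\<close>. It is a relation because the
  resolution is a choice; minimal graded free resolutions are unique up to isomorphism, hence
  \<open>\<beta>\<close> is determined by \<open>I\<close>.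
\<close>

definition graded_betti_numbers ::
    "('v::finite, 'k::comm_ring_1) mpoly set \<Rightarrow> (nat \<Rightarrow> nat \<Rightarrow> nat) \<Rightarrow> bool" where
  "graded_betti_numbers I \<beta> \<longleftrightarrow>
     (\<exists>d D. minimal_graded_free_resolution I d D \<and> (\<forall>i j. \<beta> i j = count_list (d i) j))"

section \<open>Regularity and jump sequences\<close>

text \<open>
  The \<open>+ 1\<close> makes this the regularity of the ideal \<open>I\<close>, although \<open>\<beta>\<close> is the Betti table of \<open>R/I\<close>.
\<close>

definition regularity :: "(nat \<Rightarrow> nat \<Rightarrow> nat) \<Rightarrow> int" where
  "regularity \<beta> = Max {int j - int i + 1 | i j. \<beta> i j \<noteq> 0}"

text \<open>
  The jump sequence \<open>[k; a 1, \<dots>, a (k - 1)]\<close>; the values of \<open>a\<close> outside \<open>{1..k - 1}\<close> are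
  irrelevant. The existence clause says that each of the minima is taken over a nonempty set.
  The truncated subtraction is harmless since \<open>\<beta> 0 (r + 1) = 0\<close> for \<open>r \<ge> 1\<close>.
\<close>

definition has_jump_sequence :: "(nat \<Rightarrow> nat \<Rightarrow> nat) \<Rightarrow> nat \<Rightarrow> (nat \<Rightarrow> nat) \<Rightarrow> bool" where
  "has_jump_sequence \<beta> k a \<longleftrightarrow>
     regularity \<beta> = int k + 1 \<and>
     (\<forall>r\<in>{1..k - 1}. (\<exists>i. \<beta> i (i + r + 1) \<noteq> 0) \<and>
        a r = (LEAST i. \<beta> i (i + r + 1) \<noteq> 0) - 1)"

end

(*
  By Hochster's formula, b(i, i + 3) is a sum of second cohomology groups of the independence
  complexes of induced subgraphs on i + 3 vertices, and b(2, 4) = 0 says that G has no two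
  edges forming a gap. So one has to see that the independence complex of a gap-free graph on at
  most 8 vertices has no second cohomology. In a minimal counterexample every link carries first
  cohomology and hence has at least 5 vertices. If {u, v} is an edge, the common non-neighbours of
  u and v form a simplex by gap-freeness; counting vertices, the link of v is this simplex and at
  most one more vertex, so it is acyclic, a contradiction.

  The Betti numbers of a given minimal resolution F are compared with the homology of the Koszul
  complex of R/I by shifting dimensions along F, and the latter splits by multidegree: in a
  squarefree multidegree it is the cochain complex of the independence complex, and in any other
  multidegree it is contracted by a variable occurring at least twice.
*)

theory Submission
  imports Defs
begin

section \<open>Koszul signs\<close>

text \<open>The constants: \<open>a 2 \<ge> 5\<close> means b(i, i + 3) = 0 for i <= 5, so the
  relevant multidegrees have at most 5 + 3 = 8 variables. In a squarefree multidegree W a Koszul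
  chain has the monomial of T = W - S in front of e_S. If this coefficient has degree e, then T is a
  face of dimension e - 1, so e = 3 leads to second cohomology, while b(2, 4) has e = 2. The
  obstacle is that the resolution is arbitrary: of its matrices only exactness, homogeneity and
  minimality are known. Let M_i be the cokernel of \<open>D i\<close> and F_i the free module in
  homological degree i. Minimality identifies the generators of F_(i+1) with Tor_1 of M_i, and 0 ->
  M_(i+1) -> F_i -> M_i -> 0 identifies this with Tor_(i+1) of M_0 = R/I. Both directions are
  needed: b(2, 4) = 0 is carried down to R/I to forbid gaps, and the vanishing found for R/I is
  carried up to the Betti numbers.\<close>

definition idx :: "'v::finite \<Rightarrow> nat" where
  "idx = (SOME f. inj f)"

lemma inj_idx: "inj (idx :: 'v::finite \<Rightarrow> nat)"
proof -
  have "\<exists>f :: 'v \<Rightarrow> nat. inj f"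
    using finite_imp_inj_to_nat_seg[of "UNIV :: 'v set"] by auto
  then show ?thesis unfolding idx_def by (rule someI_ex)
qed

text \<open>For s outside T this is the sign in e_s \<and> e_T = \<open>eps s T\<close> e_(T + s),
  for the arbitrary vertex order given by \<open>idx\<close>. The ring is left open because the
  signs occur both as scalars and as constant polynomials.\<close>

definition eps :: "'v::finite \<Rightarrow> 'v set \<Rightarrow> 'a::comm_ring_1" where
  "eps s T = (-1) ^ card {t \<in> T. idx t < idx s}"

lemma eps_empty [simp]: "eps s {} = 1"
  by (simp add: eps_def)

lemma eps_sq [simp]: "eps s T * eps s T = 1"
  unfolding eps_def by (simp flip: power_add)

lemma eps_cancel [simp]: "eps s T * (eps s T * x) = x"
  by (simp flip: mult.assoc)

lemma eps_insert:
  "t \<notin> T \<Longrightarrow> eps s (insert t T) = (if idx t < idx s then - eps s T else eps s T)"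
proof -
  assume t: "t \<notin> T"
  show ?thesis
  proof (cases "idx t < idx s")
    case True
    have "{u \<in> insert t T. idx u < idx s} = insert t {u \<in> T. idx u < idx s}"
      using True by auto
    then show ?thesis using True t by (simp add: eps_def)
  next
    case False
    then have "{u \<in> insert t T. idx u < idx s} = {u \<in> T. idx u < idx s}" by auto
    then show ?thesis using False by (simp add: eps_def)
  qed
qed

text \<open>Only the later of \<open>s\<close> and \<open>t\<close> counts the other one, so exactly
  one of the two signs flips. This is what makes both differentials below square to zero.\<close>

lemma eps_swap:
  assumes "s \<noteq> t" "s \<notin> T" "t \<notin> T"
  shows "eps s T * eps t (insert s T) = - (eps t T * eps s (insert t T))"
proof -
  have "idx s \<noteq> idx t" using inj_idx assms(1) by (auto dest: injD)
  then show ?thesis using assms by (auto simp: eps_insert algebra_simps)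
qed

lemma eps_insert_insert:
  assumes "s \<noteq> t" "s \<notin> T" "t \<notin> T"
  shows "eps s (insert t T) * eps t (insert s T) = - (eps s T * eps t T)"
proof -
  have "idx s \<noteq> idx t" using inj_idx assms(1) by (auto dest: injD)
  then show ?thesis using assms by (auto simp: eps_insert)
qed

text \<open>The elements of \<open>W\<close> before \<open>s\<close> split into those outside
  \<open>T\<close> and those in \<open>T - {s}\<close>. This trades the Koszul sign at the
  complement of a face for the coboundary sign at the face.\<close>

lemma eps_Diff:
  assumes "T \<subseteq> W" "s \<in> T"
  shows "(eps s (W - T) :: 'a::comm_ring_1) = eps s W * eps s (T - {s})"
proof -
  let ?B = "\<lambda>A. {t \<in> A. idx t < idx s}"
  have "?B W = ?B (W - T) \<union> ?B (T - {s})" using assms by auto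
  moreover have "?B (W - T) \<inter> ?B (T - {s}) = {}" by auto
  ultimately have "card (?B W) = card (?B (W - T)) + card (?B (T - {s}))"
    by (simp add: card_Un_disjoint)
  then have "eps s W = (eps s (W - T) * eps s (T - {s}) :: 'a)"
    by (simp add: eps_def power_add)
  then show ?thesis by (simp add: mult.assoc)
qed

text \<open>Exchanging the sums would only show that the total equals its negative, which need not
  force 0 in an abelian group; the induction cancels the pairs instead.\<close>

lemma sum_antisymmetric:
  fixes c :: "'v \<Rightarrow> 'v \<Rightarrow> 'a::ab_group_add"
  assumes "finite A" and "\<And>s t. s \<in> A \<Longrightarrow> t \<in> A \<Longrightarrow> s \<noteq> t \<Longrightarrow> c s t = - c t s"
  shows "(\<Sum>s\<in>A. \<Sum>t\<in>A - {s}. c s t) = 0"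
  using assms
proof (induction A rule: finite_induct)
  case (insert a A)
  have "(\<Sum>s\<in>A. \<Sum>t\<in>insert a A - {s}. c s t) = (\<Sum>s\<in>A. c s a + (\<Sum>t\<in>A - {s}. c s t))"
  proof (rule sum.cong[OF refl])
    fix s assume "s \<in> A"
    then have "insert a A - {s} = insert a (A - {s})" using insert.hyps by auto
    then show "(\<Sum>t\<in>insert a A - {s}. c s t) = c s a + (\<Sum>t\<in>A - {s}. c s t)"
      using insert.hyps by simp
  qed
  also have "\<dots> = (\<Sum>s\<in>A. c s a) + (\<Sum>s\<in>A. \<Sum>t\<in>A - {s}. c s t)" by (rule sum.distrib)
  also have "(\<Sum>s\<in>A. \<Sum>t\<in>A - {s}. c s t) = 0" using insert by blast
  also have "(\<Sum>s\<in>A. c s a) = (\<Sum>s\<in>A. - c a s)"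
    using insert.prems insert.hyps by (intro sum.cong) auto
  finally show ?case using insert.hyps by (simp add: sum_negf)
qed simp

section \<open>Cohomology of independence complexes\<close>

definition stable_set :: "'v set set \<Rightarrow> 'v set \<Rightarrow> bool" where
  "stable_set E T \<longleftrightarrow> (\<forall>e\<in>E. \<not> e \<subseteq> T)"

text \<open>The simplicial coboundary, on functions defined on all sets: subsets of stable sets are
  stable, so values at non-faces never enter. The empty set counts as a face, so the cohomology is
  reduced.\<close>

definition cobdry :: "('v::finite set \<Rightarrow> 'k::comm_ring_1) \<Rightarrow> 'v set \<Rightarrow> 'k" where
  "cobdry g T = (\<Sum>s\<in>T. eps s (T - {s}) * g (T - {s}))"

text \<open>
  Cochains on the independence complex of the subgraph induced on \<open>W\<close> that live on faces with
  \<open>r\<close> vertices, i.e. of dimension \<open>r - 1\<close>.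
\<close>

definition cohomology_vanishes ::
    "'k::comm_ring_1 itself \<Rightarrow> 'v::finite set set \<Rightarrow> nat \<Rightarrow> 'v set \<Rightarrow> bool" where
  "cohomology_vanishes _ E r W \<longleftrightarrow>
     (\<forall>f :: 'v set \<Rightarrow> 'k.
        (\<forall>T\<subseteq>W. stable_set E T \<longrightarrow> card T = Suc r \<longrightarrow> cobdry f T = 0) \<longrightarrow>
        (\<exists>g. \<forall>T\<subseteq>W. stable_set E T \<longrightarrow> card T = r \<longrightarrow> f T = cobdry g T))"

definition non_neighbours :: "'v set set \<Rightarrow> 'v set \<Rightarrow> 'v \<Rightarrow> 'v set" where
  "non_neighbours E W v = {u \<in> W. u \<noteq> v \<and> {u, v} \<notin> E}"

lemma stable_mono: "stable_set E T \<Longrightarrow> S \<subseteq> T \<Longrightarrow> stable_set E S"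
  unfolding stable_set_def by blast

lemma simple_graph_edgeE:
  assumes "simple_graph E" "e \<in> E"
  obtains a b where "e = {a, b}" "a \<noteq> b"
  using assms unfolding simple_graph_def by (metis card_2_iff)

lemma stable_insert:
  assumes "simple_graph E"
  shows "stable_set E (insert v T) \<longleftrightarrow>
    stable_set E T \<and> (\<forall>u\<in>T. u \<noteq> v \<longrightarrow> {u, v} \<notin> E)"
proof
  assume L: "stable_set E (insert v T)"
  have "{u, v} \<notin> E" if "u \<in> T" for u
    using L that unfolding stable_set_def by auto
  then show "stable_set E T \<and> (\<forall>u\<in>T. u \<noteq> v \<longrightarrow> {u, v} \<notin> E)"
    using stable_mono[OF L subset_insertI] by blast
next
  assume R: "stable_set E T \<and> (\<forall>u\<in>T. u \<noteq> v \<longrightarrow> {u, v} \<notin> E)"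
  show "stable_set E (insert v T)"
    unfolding stable_set_def
  proof (intro ballI notI)
    fix e assume e: "e \<in> E" "e \<subseteq> insert v T"
    obtain a b where "e = {a, b}" "a \<noteq> b" using simple_graph_edgeE[OF assms e(1)] .
    then have "e = {b, a}" by auto
    show False
    proof (cases "v \<in> e")
      case True
      then show False using e R \<open>e = {a, b}\<close> \<open>e = {b, a}\<close> \<open>a \<noteq> b\<close> by auto
    next
      case False
      then show False using e R unfolding stable_set_def by blast
    qed
  qed
qed

lemma cobdry_cobdry:
  fixes g :: "'v::finite set \<Rightarrow> 'k::comm_ring_1"
  shows "cobdry (cobdry g) T = 0"
proof -
  have "cobdry (cobdry g) T =
    (\<Sum>s\<in>T. \<Sum>t\<in>T - {s}. eps s (T - {s}) * (eps t (T - {s} - {t}) * g (T - {s} - {t})))"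
    unfolding cobdry_def by (simp add: sum_distrib_left)
  also have "\<dots> = 0"
  proof (rule sum_antisymmetric)
    fix s t assume st: "s \<in> T" "t \<in> T" "s \<noteq> t"
    define U where "U = T - {s} - {t}"
    have U: "T - {s} = insert t U" "T - {t} = insert s U" "T - {t} - {s} = U" "s \<notin> U" "t \<notin> U"
      using st by (auto simp: U_def)
    have "eps s (insert t U) * eps t U = - (eps t (insert s U) * (eps s U) :: 'k)"
      using eps_swap[OF st(3)[symmetric] U(5,4)] by (simp add: mult.commute)
    then have "eps s (insert t U) * eps t U * g U = - (eps t (insert s U) * eps s U * g U)"
      by simp
    then show "eps s (T - {s}) * (eps t (T - {s} - {t}) * g (T - {s} - {t})) =
      - (eps t (T - {t}) * (eps s (T - {t} - {s}) * g (T - {t} - {s})))"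
      unfolding U(3) U_def[symmetric] unfolding U(1,2) by (simp add: mult.assoc)
  qed simp
  finally show ?thesis .
qed

lemma cobdry_diff: "cobdry (\<lambda>T. f T - g T) T = cobdry f T - cobdry g T"
  unfolding cobdry_def by (simp add: right_diff_distrib sum_subtractf)

text \<open>The summand at \<open>v\<close> gives the opposite face \<open>U\<close>; the others
  form, up to sign, the coboundary in the link of \<open>v\<close> of the cochain contracted by
  \<open>v\<close>. The cone and the deletion argument both rest on this splitting.\<close>

lemma cobdry_insert:
  fixes f :: "'v::finite set \<Rightarrow> 'k::comm_ring_1"
  assumes "v \<notin> U"
  shows "eps v U * cobdry f (insert v U) =
    f U - cobdry (\<lambda>T. eps v T * f (insert v T)) U"
proof -
  have "cobdry f (insert v U) =
    eps v U * f U + (\<Sum>s\<in>U. eps s (insert v U - {s}) * f (insert v U - {s}))"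
    using assms unfolding cobdry_def by simp
  moreover have "eps v U * (\<Sum>s\<in>U. eps s (insert v U - {s}) * f (insert v U - {s})) =
    - cobdry (\<lambda>T. eps v T * f (insert v T)) U"
    unfolding cobdry_def sum_distrib_left sum_negf[symmetric]
  proof (rule sum.cong[OF refl])
    fix s assume s: "s \<in> U"
    define T where "T = U - {s}"
    have T: "U = insert s T" "s \<notin> T" "v \<notin> T" "s \<noteq> v" "insert v U - {s} = insert v T"
      using s assms by (auto simp: T_def)
    have "eps v (insert s T) * eps s (insert v T) = - (eps s T * eps v T :: 'k)"
      using eps_insert_insert[OF T(4,2,3)] by (simp add: mult.commute)
    then have "eps v (insert s T) * eps s (insert v T) * f (insert v T) =
      - (eps s T * eps v T * f (insert v T))" by simp
    then show "eps v U * (eps s (insert v U - {s}) * f (insert v U - {s})) =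
       - (eps s (U - {s}) * (eps v (U - {s}) * f (insert v (U - {s}))))"
      unfolding T(5) T_def[symmetric] unfolding T(1) by (simp add: mult.assoc)
  qed
  ultimately show ?thesis by (simp add: distrib_left)
qed

lemma cohomology_vanishes_empty: "r > 0 \<Longrightarrow> cohomology_vanishes K E r {}"
  unfolding cohomology_vanishes_def by auto

text \<open>The complex is a cone with apex \<open>v\<close>, and a cocycle contracted by
  \<open>v\<close> is its own primitive.\<close>

lemma cohomology_vanishes_cone:
  assumes E: "simple_graph E" and v: "v \<in> W" "\<And>u. u \<in> W \<Longrightarrow> u \<noteq> v \<Longrightarrow> {u, v} \<notin> E"
  shows "cohomology_vanishes (TYPE('k::comm_ring_1)) E r W"
  unfolding cohomology_vanishes_def
proof (intro allI impI)
  fix f :: "'a set \<Rightarrow> 'k"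
  assume f: "\<forall>T\<subseteq>W. stable_set E T \<longrightarrow> card T = Suc r \<longrightarrow> cobdry f T = 0"
  define g where "g T = (if v \<in> T then 0 else eps v T * f (insert v T))" for T
  have "f T = cobdry g T" if T: "T \<subseteq> W" "stable_set E T" "card T = r" for T
  proof (cases "v \<in> T")
    case True
    have "cobdry g T = (\<Sum>s\<in>T. if s = v then eps v (T - {v}) * g (T - {v}) else 0)"
      unfolding cobdry_def by (rule sum.cong) (auto simp: g_def True)
    also have "\<dots> = f T" using True by (simp add: g_def insert_absorb)
    finally show ?thesis by simp
  next
    case False
    have "cobdry f (insert v T) = 0"
      using f[rule_format, of "insert v T"] T v False by (auto simp: stable_insert[OF E])
    moreover have "cobdry g T = cobdry (\<lambda>T. eps v T * f (insert v T)) T"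
      unfolding cobdry_def using False by (intro sum.cong) (auto simp: g_def)
    ultimately show ?thesis using cobdry_insert[OF False, of f] by simp
  qed
  then show "\<exists>g. \<forall>T\<subseteq>W. stable_set E T \<longrightarrow> card T = r \<longrightarrow> f T = cobdry g T" by blast
qed

text \<open>The piece H^(r-1)(link of v) -> H^r(W) -> H^r(W - {v}) of the long exact sequence of a
  vertex deletion, carried out on cochains; the non-neighbours of \<open>v\<close> span the
  link.\<close>

lemma cohomology_vanishes_delete:
  assumes E: "simple_graph E" and v: "v \<in> W"
    and del: "cohomology_vanishes (TYPE('k::comm_ring_1)) E (Suc r) (W - {v})"
    and link: "cohomology_vanishes (TYPE('k)) E r (non_neighbours E W v)"
  shows "cohomology_vanishes (TYPE('k)) E (Suc r) W"
  unfolding cohomology_vanishes_def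
proof (intro allI impI)
  fix f :: "'a set \<Rightarrow> 'k"
  assume f: "\<forall>T\<subseteq>W. stable_set E T \<longrightarrow> card T = Suc (Suc r) \<longrightarrow> cobdry f T = 0"
  obtain g0 where g0: "\<And>T. T \<subseteq> W - {v} \<Longrightarrow> stable_set E T \<Longrightarrow> card T = Suc r \<Longrightarrow> f T = cobdry g0 T"
    using del f unfolding cohomology_vanishes_def by (metis Diff_subset subset_trans)
  \<comment> \<open>This difference is zero on the faces that avoid \<open>v\<close>, so only a
    cochain of the link remains.\<close>
  define f' where "f' T = f T - cobdry g0 T" for T
  have f'0: "f' T = 0" if "T \<subseteq> W - {v}" "stable_set E T" "card T = Suc r" for T
    using g0 that by (simp add: f'_def)
  have f'c: "cobdry f' T = 0" if "T \<subseteq> W" "stable_set E T" "card T = Suc (Suc r)" for T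
    using f that unfolding f'_def cobdry_diff by (simp add: cobdry_cobdry)
  define h where "h T = eps v T * f' (insert v T)" for T
  let ?N = "non_neighbours E W v"
  have vN: "v \<notin> ?N" "?N \<subseteq> W - {v}" by (auto simp: non_neighbours_def)
  have ins: "stable_set E (insert v U)" if "U \<subseteq> ?N" "stable_set E U" for U
    using that by (auto simp: stable_insert[OF E] non_neighbours_def)
  have "cobdry h U = 0" if U: "U \<subseteq> ?N" "stable_set E U" "card U = Suc r" for U
  proof -
    have vU: "v \<notin> U" using U vN by auto
    have "cobdry f' (insert v U) = 0" using f'c[of "insert v U"] U vN v ins vU by auto
    moreover have "f' U = 0" using f'0 U vN by auto
    ultimately show ?thesis using cobdry_insert[OF vU, of f'] by (simp add: h_def[abs_def])
  qed
  then obtain p where p: "\<And>U. U \<subseteq> ?N \<Longrightarrow> stable_set E U \<Longrightarrow> card U = r \<Longrightarrow> h U = cobdry p U"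
    using link unfolding cohomology_vanishes_def by metis
  \<comment> \<open>Supported on the faces through \<open>v\<close>, so the deletion is left alone;
    the minus sign cancels the one in \<open>cobdry_insert\<close>.\<close>
  define q where "q T = (if v \<in> T then - eps v (T - {v}) * p (T - {v}) else 0)" for T
  have "f' T = cobdry q T" if T: "T \<subseteq> W" "stable_set E T" "card T = Suc r" for T
  proof (cases "v \<in> T")
    case True
    define U where "U = T - {v}"
    have TU: "T = insert v U" "v \<notin> U" using True by (auto simp: U_def)
    have "stable_set E U" and "U \<subseteq> ?N" and "card U = r"
      using T TU by (auto simp: stable_insert[OF E] non_neighbours_def)
    then have "h U = cobdry p U" using p by blast
    then have 1: "eps v U * f' T = cobdry p U" by (simp add: h_def TU)
    have "cobdry (\<lambda>T. eps v T * q (insert v T)) U = (\<Sum>s\<in>U. - (eps s (U - {s}) * p (U - {s})))"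
      unfolding cobdry_def using TU(2)
      by (intro sum.cong) (auto simp: q_def)
    also have "\<dots> = - cobdry p U" by (simp add: cobdry_def sum_negf)
    finally have "eps v U * cobdry q T = cobdry p U"
      using cobdry_insert[OF TU(2), of q] TU by (simp add: q_def)
    with 1 have "eps v U * (eps v U * f' T) = eps v U * (eps v U * cobdry q T)" by simp
    then show ?thesis by simp
  next
    case False
    then have "cobdry q T = 0" unfolding cobdry_def by (intro sum.neutral) (auto simp: q_def)
    moreover have "f' T = 0" using f'0 T False by auto
    ultimately show ?thesis by simp
  qed
  then have "f T = cobdry (\<lambda>T. g0 T - - q T) T"
    if "T \<subseteq> W" "stable_set E T" "card T = Suc r" for T
  proof -
    have "cobdry (\<lambda>T. - q T) T = - cobdry q T" by (simp add: cobdry_def sum_negf)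
    then show ?thesis using \<open>\<And>T. \<lbrakk>T \<subseteq> W; stable_set E T; card T = Suc r\<rbrakk> \<Longrightarrow> f' T = cobdry q T\<close> that
      unfolding cobdry_diff by (simp add: f'_def algebra_simps)
  qed
  then show "\<exists>g. \<forall>T\<subseteq>W. stable_set E T \<longrightarrow> card T = Suc r \<longrightarrow> f T = cobdry g T" by blast
qed

section \<open>Gap-free graphs on few vertices\<close>

definition gap_free :: "'v set set \<Rightarrow> bool" where
  "gap_free E \<longleftrightarrow> (\<forall>u v a b. {u, v} \<in> E \<longrightarrow> {a, b} \<in> E \<longrightarrow> {u, v} \<inter> {a, b} = {} \<longrightarrow>
     {u, a} \<in> E \<or> {u, b} \<in> E \<or> {v, a} \<in> E \<or> {v, b} \<in> E)"

lemma gap_freeD: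
  assumes "gap_free E" "{u, v} \<in> E" "{a, b} \<in> E" "u \<noteq> a" "u \<noteq> b" "v \<noteq> a" "v \<noteq> b"
  shows "{u, a} \<in> E \<or> {u, b} \<in> E \<or> {v, a} \<in> E \<or> {v, b} \<in> E"
  using assms unfolding gap_free_def by auto

text \<open>A nonempty simplex is a cone over any of its vertices. For empty \<open>W\<close> only
  the empty face is left, and it carries a class at \<open>r = 0\<close>.\<close>

lemma cohomology_vanishes_simplex:
  assumes E: "simple_graph E" and "r > 0" and "stable_set E W"
  shows "cohomology_vanishes (TYPE('k::comm_ring_1)) E r W"
proof (cases "W = {}")
  case True
  then show ?thesis using assms by (simp add: cohomology_vanishes_empty)
next
  case False
  then obtain v where v: "v \<in> W" by auto
  show ?thesis using assms(3) by (intro cohomology_vanishes_cone[OF E v]) (auto simp: stable_set_def v)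
qed

lemma not_stableE:
  assumes "simple_graph E" "\<not> stable_set E W"
  obtains a b where "a \<in> W" "b \<in> W" "a \<noteq> b" "{a, b} \<in> E"
  using assms unfolding stable_set_def by (metis insert_subset simple_graph_edgeE)

text \<open>An edge among the non-neighbours of \<open>a\<close> avoids \<open>a\<close> and its
  neighbour \<open>b\<close>. If \<open>L\<close> has at most one vertex besides \<open>a\<close>,
  \<open>b\<close>, \<open>w\<close>, the edge must join \<open>w\<close> to that vertex.\<close>

lemma third_vertex:
  assumes ab: "{a, b} \<in> E"
    and xy: "x \<in> non_neighbours E L a" "y \<in> non_neighbours E L a" "x \<noteq> y" "{x, y} \<in> E"
    and one: "\<And>x y. x \<in> L - {a, b, w} \<Longrightarrow> y \<in> L - {a, b, w} \<Longrightarrow> x = y"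
  obtains z where "z \<in> L - {a, b, w}" "{a, z} \<notin> E" "{w, z} \<in> E"
proof -
  have nb: "z \<in> L" "z \<noteq> a" "{a, z} \<notin> E" "z \<noteq> b" if "z \<in> non_neighbours E L a" for z
    using that ab by (auto simp: non_neighbours_def insert_commute)
  consider "x = w" | "y = w" | "x \<noteq> w" "y \<noteq> w" by blast
  then show thesis
  proof cases
    case 1
    then show thesis using nb[OF xy(2)] xy(3,4) by (intro that[of y]) auto
  next
    case 2
    have "{y, x} \<in> E" using xy(4) by (simp add: insert_commute)
    then show thesis using 2 nb[OF xy(1)] xy(3) by (intro that[of x]) auto
  next
    case 3
    then have "x = y" using nb[OF xy(1)] nb[OF xy(2)] by (intro one) auto
    then show thesis using xy(3) by simp
  qed
qed

text \<open>The threat is the 4-cycle, which is the independence complex of two disjoint edges.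
  Vertices whose link is a simplex can be deleted; if there are none, every vertex has an edge among
  its non-neighbours, and four vertices are so few that this produces a gap.\<close>

lemma H1_vanishes_small:
  assumes E: "simple_graph E" and gf: "gap_free E" and "card L \<le> 4"
  shows "cohomology_vanishes (TYPE('k::comm_ring_1)) E 2 L"
  using assms(3)
proof (induction "card L" arbitrary: L rule: less_induct)
  case less
  show ?case
  proof (cases "\<exists>w\<in>L. stable_set E (non_neighbours E L w)")
    case True
    then obtain w where w: "w \<in> L" "stable_set E (non_neighbours E L w)" by blast
    have "card (L - {w}) < card L" using w by (meson card_Diff1_less finite)
    then have "cohomology_vanishes (TYPE('k)) E 2 (L - {w})" using less by auto
    then show ?thesis
      using cohomology_vanishes_delete[OF E w(1), of 1, where 'k='k]
        cohomology_vanishes_simplex[OF E _ w(2), where 'k='k]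
      by (simp add: numeral_2_eq_2)
  next
    case False
    show ?thesis
    proof (cases "L = {}")
      case True
      then show ?thesis by (simp add: cohomology_vanishes_empty)
    next
      case nonempty: False
      then obtain w where w: "w \<in> L" by auto
      have nb: "\<not> stable_set E (non_neighbours E L x)" if "x \<in> L" for x
        using False that by blast
      obtain a b where ab: "a \<in> non_neighbours E L w" "b \<in> non_neighbours E L w" "a \<noteq> b" "{a, b} \<in> E"
        using not_stableE[OF E nb[OF w]] by auto
      have abw: "card {a, b, w} = 3" "{a, b, w} \<subseteq> L"
        using ab w by (auto simp: non_neighbours_def)
      have abL: "a \<in> L" "b \<in> L" using abw by auto
      have c: "card (L - {a, b, w}) \<le> 1"
        using abw less.prems by (simp add: card_Diff_subset)
      obtain a1 a2 where a12: "a1 \<in> non_neighbours E L a" "a2 \<in> non_neighbours E L a" "a1 \<noteq> a2" "{a1, a2} \<in> E"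
        using not_stableE[OF E nb[OF abL(1)]] .
      obtain b1 b2 where b12: "b1 \<in> non_neighbours E L b" "b2 \<in> non_neighbours E L b" "b1 \<noteq> b2" "{b1, b2} \<in> E"
        using not_stableE[OF E nb[OF abL(2)]] .
      have one: "x = y" if "x \<in> L - {a, b, w}" "y \<in> L - {a, b, w}" for x y
        using c that card_le_Suc0_iff_eq[of "L - {a, b, w}", OF finite] unfolding One_nat_def by blast
      obtain x where x: "x \<in> L - {a, b, w}" "{a, x} \<notin> E" "{w, x} \<in> E"
        using third_vertex[OF ab(4) a12] one by metis
      have ba: "{b, a} \<in> E" "L - {b, a, w} = L - {a, b, w}" using ab by (auto simp: insert_commute)
      obtain y where y: "y \<in> L - {a, b, w}" "{b, y} \<notin> E"
        using third_vertex[OF ba(1) b12, of w] one unfolding ba(2) by metis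
      \<comment> \<open>\<open>x\<close> is now the fourth vertex, adjacent to \<open>w\<close> but
        to neither \<open>a\<close> nor \<open>b\<close>, so \<open>{a, b}\<close> and
        \<open>{w, x}\<close> would form a gap.\<close>
      have "y = x" using one x y by blast
      then have "{a, w} \<in> E \<or> {a, x} \<in> E \<or> {b, w} \<in> E \<or> {b, x} \<in> E"
        using x y ab by (intro gap_freeD[OF gf ab(4) x(3)]) (auto simp: non_neighbours_def)
      then show ?thesis using ab x y \<open>y = x\<close> by (auto simp: non_neighbours_def)
    qed
  qed
qed

text \<open>For a vertex outside \<open>K\<close>, both its deletion and its link are simplices
  inside \<open>K\<close>.\<close>

lemma H1_vanishes_simplex_plus_vertex:
  assumes E: "simple_graph E" and "card (L - K) \<le> 1" and "stable_set E K"
  shows "cohomology_vanishes (TYPE('k::comm_ring_1)) E 2 L"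
proof (cases "L \<subseteq> K")
  case True
  then show ?thesis using assms by (intro cohomology_vanishes_simplex) (auto intro: stable_mono)
next
  case False
  then obtain w where w: "w \<in> L" "w \<notin> K" by auto
  have "x = w" if "x \<in> L - K" for x
    using assms(2) that w card_le_Suc0_iff_eq[of "L - K", OF finite] unfolding One_nat_def by blast
  then have 1: "L - {w} \<subseteq> K" by auto
  then have 2: "non_neighbours E L w \<subseteq> K" by (auto simp: non_neighbours_def)
  have "cohomology_vanishes (TYPE('k)) E 2 (L - {w})"
    by (rule cohomology_vanishes_simplex[OF E _ stable_mono[OF assms(3) 1]]) simp
  moreover have "cohomology_vanishes (TYPE('k)) E 1 (non_neighbours E L w)"
    by (rule cohomology_vanishes_simplex[OF E _ stable_mono[OF assms(3) 2]]) simp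
  ultimately show ?thesis
    using cohomology_vanishes_delete[OF E w(1), of 1, where 'k='k] by (simp add: numeral_2_eq_2)
qed

text \<open>
  The non-neighbours of a vertex span its link. The common non-neighbours of the ends of an edge
  form a simplex, and if both links have at least five vertices, then one is this simplex and at
  most one more vertex.
\<close>

lemma H2_vanishes_small:
  assumes E: "simple_graph E" and gf: "gap_free E" and "card W \<le> 8"
  shows "cohomology_vanishes (TYPE('k::comm_ring_1)) E 3 W"
  using assms(3)
proof (induction "card W" arbitrary: W rule: less_induct)
  case less
  \<comment> \<open>Induction settles the deletion of \<open>v\<close>, so it suffices to find one
    vertex whose link has no first cohomology.\<close>
  have red: ?case if v: "v \<in> W" and l: "cohomology_vanishes (TYPE('k)) E 2 (non_neighbours E W v)" for v
  proof -
    have "card (W - {v}) < card W" using v by (meson card_Diff1_less finite)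
    then have "cohomology_vanishes (TYPE('k)) E 3 (W - {v})" using less by auto
    then show ?thesis using cohomology_vanishes_delete[OF E v, of 2] l by (simp add: numeral_3_eq_3 numeral_2_eq_2)
  qed
  show ?case
  proof (cases "stable_set E W")
    case True
    then show ?thesis by (intro cohomology_vanishes_simplex[OF E]) auto
  next
    case False
    obtain u v where uv: "u \<in> W" "v \<in> W" "u \<noteq> v" "{u, v} \<in> E"
      using not_stableE[OF E False] .
    let ?U = "non_neighbours E W u" and ?V = "non_neighbours E W v"
    show ?thesis
    proof (cases "card ?U \<le> 4 \<or> card ?V \<le> 4")
      case True
      then show ?thesis using red uv H1_vanishes_small[OF E gf] by blast
    next
      case c: False
      have ind: "stable_set E (?U \<inter> ?V)"
      proof (rule ccontr)
        assume "\<not> stable_set E (?U \<inter> ?V)"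
        then obtain a b where ab: "a \<in> ?U \<inter> ?V" "b \<in> ?U \<inter> ?V" "{a, b} \<in> E"
          using not_stableE[OF E] by metis
        then have "{u, a} \<in> E \<or> {u, b} \<in> E \<or> {v, a} \<in> E \<or> {v, b} \<in> E"
          using uv by (intro gap_freeD[OF gf uv(4) ab(3)]) (auto simp: non_neighbours_def)
        then show False using ab by (auto simp: non_neighbours_def insert_commute)
      qed
      have "?U \<union> ?V \<subseteq> W - {u, v}" using uv by (auto simp: non_neighbours_def insert_commute)
      then have "card (?U \<union> ?V) \<le> card (W - {u, v})" by (simp add: card_mono)
      also have "card (W - {u, v}) \<le> 6" using uv less.prems by (simp add: card_Diff_subset)
      finally have "card (?U \<union> ?V) \<le> 6" .
      moreover have "card (?U \<union> ?V) = card ?U + card (?V - ?U)"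
        using card_Un_disjoint[of ?U "?V - ?U"] by simp
      \<comment> \<open>At most six vertices lie off the edge, and \<open>?U\<close> takes at least
        five of them.\<close>
      ultimately have "card (?V - ?U) \<le> 1" using c by simp
      then have "card (?V - (?U \<inter> ?V)) \<le> 1" by (simp add: Diff_Int)
      then show ?thesis
        using red uv(2) H1_vanishes_simplex_plus_vertex[OF E _ ind] by blast
    qed
  qed
qed

section \<open>The Koszul complex of the polynomial ring\<close>

lemma lookup_var_mult:
  "Poly_Mapping.lookup (var i * p) m =
    (if 0 < Poly_Mapping.lookup m i then Poly_Mapping.lookup p (m - Poly_Mapping.single i 1) else 0)"
proof -
  let ?a = "Poly_Mapping.single i (1::nat)"
  have "Poly_Mapping.lookup (var i * p) m = Sum_any (\<lambda>q. Poly_Mapping.lookup p q when m = ?a + q)"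
    by (simp add: var_def lookup_mult lookup_single when_mult)
  also have "\<dots> = (if 0 < Poly_Mapping.lookup m i then Poly_Mapping.lookup p (m - ?a) else 0)"
  proof (cases "0 < Poly_Mapping.lookup m i")
    case True
    then have "?a + (m - ?a) = m"
      by (intro poly_mapping_eqI) (auto simp: lookup_add lookup_minus lookup_single when_def)
    then have "m = ?a + q \<longleftrightarrow> q = m - ?a" for q by auto
    then show ?thesis using True by simp
  next
    case False
    then have "m \<noteq> ?a + q" for q by (auto simp: lookup_add lookup_single)
    then show ?thesis using False by simp
  qed
  finally show ?thesis .
qed

lemma lookup_eps_mult:
  fixes p :: "('v::finite, 'k::comm_ring_1) mpoly"
  shows "Poly_Mapping.lookup (eps s S * p) m = eps s S * Poly_Mapping.lookup p m"
proof -
  have "(eps s S :: ('v, 'k) mpoly) = 1 \<and> (eps s S :: 'k) = 1 \<or>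
        (eps s S :: ('v, 'k) mpoly) = -1 \<and> (eps s S :: 'k) = -1"
    unfolding eps_def by (cases "even (card {t \<in> S. idx t < idx s})") auto
  then show ?thesis by auto
qed

text \<open>The Koszul differential of the chain with coefficient \<open>\<omega> T\<close> at e_T,
  read off at e_S: each e_(S + s) contributes x_s e_S with sign \<open>eps s S\<close>.\<close>

definition kdiff :: "('v::finite set \<Rightarrow> ('v, 'k::comm_ring_1) mpoly) \<Rightarrow> 'v set \<Rightarrow> ('v, 'k) mpoly" where
  "kdiff \<omega> S = (\<Sum>s\<in>-S. eps s S * (var s * \<omega> (insert s S)))"

lemma kdiff_kdiff: "kdiff (kdiff \<omega>) S = (0 :: ('v::finite, 'k::comm_ring_1) mpoly)"
proof -
  have ins: "- insert s S = - S - {s}" for s by auto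
  have "kdiff (kdiff \<omega>) S = (\<Sum>s\<in>-S. \<Sum>t\<in>-S - {s}.
      eps s S * (var s * (eps t (insert s S) * (var t * \<omega> (insert t (insert s S))))))"
    by (simp add: kdiff_def sum_distrib_left ins)
  also have "\<dots> = 0"
  proof (rule sum_antisymmetric)
    fix s t assume st: "s \<in> -S" "t \<in> -S" "s \<noteq> t"
    have "eps s S * (var s * (eps t (insert s S) * (var t * \<omega> (insert t (insert s S))))) =
       (eps s S * eps t (insert s S)) * (var s * (var t * \<omega> (insert t (insert s S))))"
      by (simp add: mult_ac)
    also have "eps s S * eps t (insert s S) = - (eps t S * eps s (insert t S) :: ('v, 'k) mpoly)"
      using st by (intro eps_swap) auto
    finally show "eps s S * (var s * (eps t (insert s S) * (var t * \<omega> (insert t (insert s S))))) =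
      - (eps t S * (var t * (eps s (insert t S) * (var s * \<omega> (insert s (insert t S))))))"
      by (simp add: mult_ac insert_commute)
  qed simp
  finally show ?thesis .
qed

lemma lookup_kdiff:
  "Poly_Mapping.lookup (kdiff \<omega> S) m = (\<Sum>s\<in>-S. if 0 < Poly_Mapping.lookup m s
     then eps s S * Poly_Mapping.lookup (\<omega> (insert s S)) (m - Poly_Mapping.single s 1) else 0)"
  unfolding kdiff_def lookup_sum by (intro sum.cong) (auto simp: lookup_eps_mult lookup_var_mult)

text \<open>The multidegree of e_S; thus x^m e_S has multidegree
  \<open>m + set_monom S\<close>.\<close>

definition set_monom :: "'v::finite set \<Rightarrow> ('v \<Rightarrow>\<^sub>0 nat)" where
  "set_monom S = (\<Sum>s\<in>S. Poly_Mapping.single s 1)"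

lemma lookup_set_monom: "Poly_Mapping.lookup (set_monom S) v = (if v \<in> S then 1 else 0)"
  by (simp add: set_monom_def lookup_sum lookup_single when_def)

lemma keys_set_monom [simp]: "Poly_Mapping.keys (set_monom S) = S"
  by (auto simp: in_keys_iff lookup_set_monom split: if_splits)

lemma set_monom_insert: "s \<notin> S \<Longrightarrow> set_monom (insert s S) = Poly_Mapping.single s 1 + set_monom S"
  by (simp add: set_monom_def)

lemma monom_degree_add: "monom_degree (m + n) = monom_degree m + monom_degree n"
  by (simp add: monom_degree_def lookup_add sum.distrib)

lemma monom_degree_single [simp]: "monom_degree (Poly_Mapping.single s n) = n"
  by (simp add: monom_degree_def lookup_single when_def)

lemma monom_degree_set_monom [simp]: "monom_degree (set_monom S) = card S"
  by (simp add: monom_degree_def lookup_set_monom sum.If_cases)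

lemma diff_single_add:
  "0 < Poly_Mapping.lookup m s \<Longrightarrow> m - Poly_Mapping.single s (1::nat) + Poly_Mapping.single s 1 = m"
  by (intro poly_mapping_eqI) (auto simp: lookup_add lookup_minus lookup_single when_def)

lemma monom_degree_diff_single:
  assumes "0 < Poly_Mapping.lookup m s"
  shows "int (monom_degree (m - Poly_Mapping.single s 1)) = int (monom_degree m) - 1"
  using arg_cong[OF diff_single_add[OF assms], of monom_degree]
  by (simp add: monom_degree_add)

lemma diff_single_set_monom:
  assumes "0 < Poly_Mapping.lookup m s" "s \<notin> S"
  shows "m - Poly_Mapping.single s 1 + set_monom (insert s S) = m + set_monom S"
  using diff_single_add[OF assms(1)] assms(2) by (simp add: set_monom_insert add.assoc[symmetric])

lemma finite_monom_degree: "finite {m :: 'v::finite \<Rightarrow>\<^sub>0 nat. monom_degree m = n}"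
proof (rule finite_imageD)
  have "Poly_Mapping.lookup m v \<le> monom_degree m" for m :: "'v \<Rightarrow>\<^sub>0 nat" and v
    unfolding monom_degree_def by (rule member_le_sum) auto
  then have "Poly_Mapping.lookup ` {m :: 'v \<Rightarrow>\<^sub>0 nat. monom_degree m = n} \<subseteq> PiE UNIV (\<lambda>_. {..n})"
    by (auto simp: PiE_def)
  moreover have "finite (PiE (UNIV :: 'v set) (\<lambda>_. {..n}))"
    by (rule finite_PiE) simp_all
  ultimately show "finite (Poly_Mapping.lookup ` {m :: 'v \<Rightarrow>\<^sub>0 nat. monom_degree m = n})"
    by (rule finite_subset)
  show "inj_on Poly_Mapping.lookup {m :: 'v \<Rightarrow>\<^sub>0 nat. monom_degree m = n}"
    by (rule inj_onI, rule poly_mapping_eqI, rule fun_cong)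
qed

text \<open>Integer degrees, because degree shifts can become negative; then 0 is the only
  homogeneous polynomial.\<close>

definition homogeneous :: "int \<Rightarrow> ('v::finite, 'k::zero) mpoly \<Rightarrow> bool" where
  "homogeneous e p \<longleftrightarrow> (\<forall>m\<in>Poly_Mapping.keys p. int (monom_degree m) = e)"

lemma lookup_homogeneous:
  "homogeneous e p \<Longrightarrow> int (monom_degree m) \<noteq> e \<Longrightarrow> Poly_Mapping.lookup p m = 0"
  by (auto simp: homogeneous_def in_keys_iff)

text \<open>The Koszul complex splits by multidegree \<open>\<alpha>\<close>. There \<open>S\<close>
  determines the monomial, so a chain is just a function \<open>c\<close> on sets, and solutions in
  the single multidegrees are glued to polynomials. \<open>good\<close> selects the monomials at
  which the equation is demanded: all, those of stable support (working modulo the edge ideal), or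
  all but 1.\<close>

lemma koszul_assemble:
  fixes \<eta> :: "'v::finite set \<Rightarrow> ('v, 'k::comm_ring_1) mpoly"
  assumes hom: "\<And>S. card S = p \<Longrightarrow> homogeneous e (\<eta> S)"
    and local: "\<And>\<alpha>. int (monom_degree \<alpha>) = int p + e \<Longrightarrow> \<exists>c. \<forall>S m.
      card S = p \<longrightarrow> m + set_monom S = \<alpha> \<longrightarrow> good m \<longrightarrow>
      Poly_Mapping.lookup (\<eta> S) m =
        (\<Sum>s\<in>-S. if 0 < Poly_Mapping.lookup m s then eps s S * c (insert s S) else 0)"
  obtains \<theta> where "\<And>T. homogeneous (e - 1) (\<theta> T)" "\<And>T. card T \<noteq> Suc p \<Longrightarrow> \<theta> T = 0"
    "\<And>S m. card S = p \<Longrightarrow> good m \<Longrightarrow>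
       Poly_Mapping.lookup (kdiff \<theta> S) m = Poly_Mapping.lookup (\<eta> S) m"
proof -
  define sol where "sol \<alpha> c \<longleftrightarrow> (\<forall>S m. card S = p \<longrightarrow> m + set_monom S = \<alpha> \<longrightarrow> good m \<longrightarrow>
      Poly_Mapping.lookup (\<eta> S) m =
        (\<Sum>s\<in>-S. if 0 < Poly_Mapping.lookup m s then eps s S * c (insert s S) else 0))" for \<alpha> c
  define c where "c \<alpha> = (SOME c. sol \<alpha> c)" for \<alpha>
  have "sol \<alpha> (c \<alpha>)" if "int (monom_degree \<alpha>) = int p + e" for \<alpha>
  proof -
    have "\<exists>c. sol \<alpha> c" unfolding sol_def by (rule local[OF that])
    then show ?thesis unfolding c_def by (rule someI_ex)
  qed
  then have c: "Poly_Mapping.lookup (\<eta> S) m =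
      (\<Sum>s\<in>-S. if 0 < Poly_Mapping.lookup m s then eps s S * c (m + set_monom S) (insert s S) else 0)"
    if "int (monom_degree (m + set_monom S)) = int p + e" "card S = p" "good m" for S m
    using that unfolding sol_def by simp
  \<comment> \<open>One more element in \<open>T\<close> leaves degree \<open>e - 1\<close> for the
    coefficient; fixing that degree makes the support finite.\<close>
  define F where "F T m = (if card T = Suc p \<and> int (monom_degree m) = e - 1
    then c (m + set_monom T) T else 0)" for T m
  define \<theta> where "\<theta> T = Abs_poly_mapping (F T)" for T
  have "finite {m. F T m \<noteq> 0}" for T
    by (rule finite_subset[OF _ finite_monom_degree[of "nat (e - 1)"]]) (auto simp: F_def split: if_splits)
  then have lookup: "Poly_Mapping.lookup (\<theta> T) m = F T m" for T m
    by (simp add: \<theta>_def)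
  have "Poly_Mapping.lookup (kdiff \<theta> S) m = Poly_Mapping.lookup (\<eta> S) m"
    if S: "card S = p" and m: "good m" for S m
  proof (cases "int (monom_degree m) = e")
    case True
    have "Poly_Mapping.lookup (kdiff \<theta> S) m =
      (\<Sum>s\<in>-S. if 0 < Poly_Mapping.lookup m s then eps s S * c (m + set_monom S) (insert s S) else 0)"
      unfolding lookup_kdiff
    proof (intro sum.cong refl if_cong)
      fix s assume s: "s \<in> -S" "0 < Poly_Mapping.lookup m s"
      have "card (insert s S) = Suc p" using s S by simp
      moreover have "int (monom_degree (m - Poly_Mapping.single s 1)) = e - 1"
        using monom_degree_diff_single[OF s(2)] True by simp
      ultimately show "eps s S * Poly_Mapping.lookup (\<theta> (insert s S)) (m - Poly_Mapping.single s 1) =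
        eps s S * c (m + set_monom S) (insert s S)"
        using diff_single_set_monom[OF s(2)] s(1) unfolding lookup F_def by simp
    qed
    then show ?thesis using c[OF _ S m] S True by (simp add: monom_degree_add)
  next
    case False
    have "Poly_Mapping.lookup (kdiff \<theta> S) m = 0"
      unfolding lookup_kdiff
    proof (intro sum.neutral ballI)
      fix s
      show "(if 0 < Poly_Mapping.lookup m s then
          eps s S * Poly_Mapping.lookup (\<theta> (insert s S)) (m - Poly_Mapping.single s 1) else 0) = 0"
        using monom_degree_diff_single[of m s] False unfolding lookup F_def by auto
    qed
    then show ?thesis using lookup_homogeneous[OF hom[OF S] False] by simp
  qed
  moreover have "homogeneous (e - 1) (\<theta> T)" for T
    by (auto simp: homogeneous_def in_keys_iff lookup F_def split: if_splits)
  moreover have "\<theta> T = 0" if "card T \<noteq> Suc p" for T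
    using that by (intro poly_mapping_eqI) (simp add: lookup F_def)
  ultimately show thesis using that by blast
qed

text \<open>The contracting homotopy that divides the monomial by x_v and multiplies by e_v. It
  needs the cycle condition at a monomial with an additional factor x_v, whence
  \<open>ext\<close>.\<close>

lemma koszul_homotopy:
  fixes \<eta> :: "'v::finite set \<Rightarrow> ('v, 'k::comm_ring_1) mpoly"
  assumes v: "0 < Poly_Mapping.lookup \<alpha> v"
    and ext: "\<And>S m. m + set_monom S = \<alpha> \<Longrightarrow> v \<in> S \<Longrightarrow> good m \<Longrightarrow> good (m + Poly_Mapping.single v 1)"
    and cycle: "\<And>S m. Suc (card S) = p \<Longrightarrow> good m \<Longrightarrow> Poly_Mapping.lookup (kdiff \<eta> S) m = 0"
  shows "\<exists>c. \<forall>S m. card S = p \<longrightarrow> m + set_monom S = \<alpha> \<longrightarrow> good m \<longrightarrow>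
      Poly_Mapping.lookup (\<eta> S) m =
        (\<Sum>s\<in>-S. if 0 < Poly_Mapping.lookup m s then eps s S * c (insert s S) else 0)"
proof (intro exI allI impI)
  define c where "c T = (if v \<in> T
    then eps v (T - {v}) * Poly_Mapping.lookup (\<eta> (T - {v})) (\<alpha> - set_monom (T - {v})) else 0)" for T
  fix S m assume S: "card S = p" and m: "m + set_monom S = \<alpha>" and good: "good m"
  show "Poly_Mapping.lookup (\<eta> S) m =
        (\<Sum>s\<in>-S. if 0 < Poly_Mapping.lookup m s then eps s S * c (insert s S) else 0)"
  proof (cases "v \<in> S")
    case False
    then have mv: "0 < Poly_Mapping.lookup m v"
      using v m by (auto simp: lookup_add lookup_set_monom)
    have "(\<Sum>s\<in>-S. if 0 < Poly_Mapping.lookup m s then eps s S * c (insert s S) else 0) =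
       (\<Sum>s\<in>-S. if s = v then eps v S * c (insert v S) else 0)"
      by (intro sum.cong) (auto simp: c_def False mv)
    also have "\<dots> = Poly_Mapping.lookup (\<eta> S) m"
      using False by (simp add: c_def flip: m)
    finally show ?thesis by simp
  next
    case True
    define T where "T = S - {v}"
    have T: "S = insert v T" "v \<notin> T" using True by (auto simp: T_def)
    let ?m = "m + Poly_Mapping.single v 1"
    let ?t = "\<lambda>s. if 0 < Poly_Mapping.lookup m s
      then eps s T * Poly_Mapping.lookup (\<eta> (insert s T)) (?m - Poly_Mapping.single s 1) else 0"
    \<comment> \<open>Moving \<open>v\<close> from \<open>S\<close> into the monomial keeps the
      multidegree. The cycle condition there expresses the coefficient at \<open>S\<close> by
      coefficients at sets without \<open>v\<close>.\<close>
    have "0 = Poly_Mapping.lookup (kdiff \<eta> T) ?m"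
      using cycle[of T ?m] ext[OF m True good] S T by simp
    also have "\<dots> = (\<Sum>s\<in>insert v (-S). if 0 < Poly_Mapping.lookup ?m s
      then eps s T * Poly_Mapping.lookup (\<eta> (insert s T)) (?m - Poly_Mapping.single s 1) else 0)"
      unfolding lookup_kdiff using T by (intro sum.cong) auto
    also have "\<dots> = eps v T * Poly_Mapping.lookup (\<eta> S) m + (\<Sum>s\<in>-S. ?t s)"
      using True T(1) by (simp add: lookup_add lookup_single when_def) (intro sum.cong, auto)
    finally have 1: "(\<Sum>s\<in>-S. ?t s) = - (eps v T * Poly_Mapping.lookup (\<eta> S) m)"
      by (simp add: add_eq_0_iff)
    have "(\<Sum>s\<in>-S. if 0 < Poly_Mapping.lookup m s then eps s S * c (insert s S) else 0) =
      (\<Sum>s\<in>-S. - (eps v T * ?t s))"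
    proof (intro sum.cong refl)
      fix s assume s: "s \<in> -S"
      then have sv: "s \<noteq> v" "s \<notin> T" using T by auto
      have "\<alpha> - set_monom (insert s T) = ?m - Poly_Mapping.single s 1"
        unfolding m[symmetric] T(1) using T(2) sv
        by (intro poly_mapping_eqI) (auto simp: lookup_add lookup_minus lookup_set_monom lookup_single when_def)
      moreover have "insert s S - {v} = insert s T" using T sv by auto
      ultimately have "eps s S * c (insert s S) = (eps s (insert v T) * eps v (insert s T)) *
          Poly_Mapping.lookup (\<eta> (insert s T)) (?m - Poly_Mapping.single s 1)"
        using T(1) by (simp add: c_def)
      then show "(if 0 < Poly_Mapping.lookup m s then eps s S * c (insert s S) else 0) = - (eps v T * ?t s)"
        using eps_insert_insert[OF sv T(2), where 'b='k] by (simp add: mult_ac)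
    qed
    also have "\<dots> = - (eps v T * (\<Sum>s\<in>-S. ?t s))" by (simp add: sum_negf sum_distrib_left)
    also have "\<dots> = Poly_Mapping.lookup (\<eta> S) m" unfolding 1 by simp
    finally show ?thesis by simp
  qed
qed

text \<open>Any variable dividing \<open>\<alpha>\<close> contracts that multidegree;
  \<open>p > 0\<close> excludes the constant multidegree, which has no variable.\<close>

lemma koszul_exact:
  fixes \<eta> :: "'v::finite set \<Rightarrow> ('v, 'k::comm_ring_1) mpoly"
  assumes "p > 0" and hom: "\<And>S. card S = p \<Longrightarrow> homogeneous e (\<eta> S)"
    and cycle: "\<And>S. Suc (card S) = p \<Longrightarrow> kdiff \<eta> S = 0"
  obtains \<theta> where "\<And>T. homogeneous (e - 1) (\<theta> T)" "\<And>T. card T \<noteq> Suc p \<Longrightarrow> \<theta> T = 0"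
    "\<And>S. card S = p \<Longrightarrow> kdiff \<theta> S = \<eta> S"
proof (rule koszul_assemble[of p e \<eta> "\<lambda>_. True", OF hom])
  fix \<alpha> :: "'v \<Rightarrow>\<^sub>0 nat"
  show "\<exists>c. \<forall>S m. card S = p \<longrightarrow> m + set_monom S = \<alpha> \<longrightarrow> True \<longrightarrow> Poly_Mapping.lookup (\<eta> S) m =
        (\<Sum>s\<in>-S. if 0 < Poly_Mapping.lookup m s then eps s S * c (insert s S) else 0)"
  proof (cases "\<alpha> = 0")
    case True
    have "card S \<noteq> p" if "m + set_monom S = \<alpha>" for S and m :: "'v \<Rightarrow>\<^sub>0 nat"
      using arg_cong[OF that, of monom_degree] \<open>p > 0\<close> True
      by (simp add: monom_degree_add) (simp add: monom_degree_def)
    then show ?thesis by blast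
  next
    case False
    then obtain v where "0 < Poly_Mapping.lookup \<alpha> v"
      by (metis gr0I lookup_zero poly_mapping_eqI)
    then show ?thesis by (rule koszul_homotopy) (simp_all add: cycle)
  qed
next
  fix \<theta>
  assume "\<And>T. homogeneous (e - 1) (\<theta> T)" "\<And>T. card T \<noteq> Suc p \<Longrightarrow> \<theta> T = 0"
    "\<And>S m. card S = p \<Longrightarrow> True \<Longrightarrow>
       Poly_Mapping.lookup (kdiff \<theta> S) m = Poly_Mapping.lookup (\<eta> S) m"
  then show thesis by (intro that[of \<theta>]) (simp_all add: poly_mapping_eqI)
qed

section \<open>The Koszul complex of an edge ideal\<close>

lemma keys_add_nat:
  "Poly_Mapping.keys (m + n :: 'v \<Rightarrow>\<^sub>0 nat) = Poly_Mapping.keys m \<union> Poly_Mapping.keys n"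
  by (auto simp: in_keys_iff lookup_add)

lemma poly_mapping_sum_single: "p = (\<Sum>m\<in>Poly_Mapping.keys p. Poly_Mapping.single m (Poly_Mapping.lookup p m))"
proof (rule poly_mapping_eqI)
  fix k
  have "(\<Sum>m\<in>Poly_Mapping.keys p. Poly_Mapping.lookup p m when m = k) =
      (\<Sum>m\<in>Poly_Mapping.keys p. if m = k then Poly_Mapping.lookup p k else 0)"
    by (rule sum.cong) (auto simp: when_def)
  also have "\<dots> = Poly_Mapping.lookup p k" by (simp add: in_keys_iff)
  finally show "Poly_Mapping.lookup p k =
    Poly_Mapping.lookup (\<Sum>m\<in>Poly_Mapping.keys p. Poly_Mapping.single m (Poly_Mapping.lookup p m)) k"
    by (simp add: lookup_sum lookup_single)
qed

lemma var_mult_var: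
  "var i * var j = Poly_Mapping.single (Poly_Mapping.single i 1 + Poly_Mapping.single j 1) 1"
  by (simp add: var_def mult_single)

text \<open>A monomial ideal is tested monomial by monomial; consequently the monomials of stable
  support form a basis of R/I.\<close>

lemma mem_edge_ideal_iff:
  fixes p :: "('v::finite, 'k::comm_ring_1) mpoly"
  assumes E: "simple_graph E"
  shows "p \<in> edge_ideal E \<longleftrightarrow> (\<forall>m\<in>Poly_Mapping.keys p. \<not> stable_set E (Poly_Mapping.keys m))"
proof
  interpret M: Modules.module "(*) :: ('v, 'k) mpoly \<Rightarrow> _" by (rule module_times)
  let ?G = "{var i * var j | i j. {i, j} \<in> E} :: ('v, 'k) mpoly set"
  let ?I = "{p :: ('v, 'k) mpoly. \<forall>m\<in>Poly_Mapping.keys p. \<not> stable_set E (Poly_Mapping.keys m)}"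
  {
    assume "p \<in> edge_ideal E"
    moreover have "M.span ?G \<subseteq> ?I"
    proof (rule M.span_minimal)
      show "?G \<subseteq> ?I"
      proof clarify
        fix i j m assume "{i, j} \<in> E" and m: "m \<in> Poly_Mapping.keys (var i * var j :: ('v, 'k) mpoly)"
          and st: "stable_set E (Poly_Mapping.keys m)"
        have "m = Poly_Mapping.single i 1 + Poly_Mapping.single j 1"
          using m by (simp add: var_mult_var split: if_splits)
        then have "{i, j} \<subseteq> Poly_Mapping.keys m" by (simp add: keys_add_nat)
        then show False using \<open>{i, j} \<in> E\<close> st unfolding stable_set_def by blast
      qed
      show "M.subspace ?I"
      proof (rule M.subspaceI)
        fix x y assume "x \<in> ?I" "y \<in> ?I"
        then show "x + y \<in> ?I" using keys_add[of x y] by blast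
      next
        fix c x assume x: "x \<in> ?I"
        show "c * x \<in> ?I"
        proof clarify
          fix m assume "m \<in> Poly_Mapping.keys (c * x)" and st: "stable_set E (Poly_Mapping.keys m)"
          then obtain a b where "m = a + b" "b \<in> Poly_Mapping.keys x" using keys_mult[of c x] by blast
          moreover then have "stable_set E (Poly_Mapping.keys b)"
            using st by (auto simp: keys_add_nat intro: stable_mono)
          ultimately show False using x by blast
        qed
      qed simp
    qed
    ultimately show "\<forall>m\<in>Poly_Mapping.keys p. \<not> stable_set E (Poly_Mapping.keys m)"
      unfolding edge_ideal_def ideal_generated_def by blast
  }
  {
    assume p: "\<forall>m\<in>Poly_Mapping.keys p. \<not> stable_set E (Poly_Mapping.keys m)"
    have "Poly_Mapping.single m c \<in> M.span ?G" if ns: "\<not> stable_set E (Poly_Mapping.keys m)" for m c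
    proof -
      obtain i j where ij: "i \<in> Poly_Mapping.keys m" "j \<in> Poly_Mapping.keys m" "i \<noteq> j" "{i, j} \<in> E"
        using not_stableE[OF E ns] .
      let ?s = "Poly_Mapping.single i 1 + Poly_Mapping.single j (1::nat)"
      have "m = (m - ?s) + ?s"
        using ij by (intro poly_mapping_eqI) (auto simp: in_keys_iff lookup_add lookup_minus lookup_single when_def)
      then have "Poly_Mapping.single m c = Poly_Mapping.single (m - ?s) c * (var i * var j)"
        by (simp add: var_mult_var mult_single)
      moreover have "var i * var j \<in> M.span ?G" using ij(4) by (intro M.span_base) blast
      ultimately show ?thesis by (simp only: M.span_scale)
    qed
    then have "(\<Sum>m\<in>Poly_Mapping.keys p. Poly_Mapping.single m (Poly_Mapping.lookup p m)) \<in> M.span ?G"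
      using p by (intro M.span_sum) blast
    then show "p \<in> edge_ideal E"
      unfolding edge_ideal_def ideal_generated_def using poly_mapping_sum_single[of p] by simp
  }
qed

lemma homogeneous_diff:
  "homogeneous e p \<Longrightarrow> homogeneous e q \<Longrightarrow> homogeneous e (p - q :: ('v::finite, 'k::ab_group_add) mpoly)"
  unfolding homogeneous_def using keys_diff[of p q] by blast

lemma homogeneous_0 [simp]: "homogeneous e 0"
  by (simp add: homogeneous_def)

lemma homogeneous_kdiff:
  assumes "\<And>T. homogeneous (e - 1) (\<omega> T)"
  shows "homogeneous e (kdiff \<omega> S)"
  unfolding homogeneous_def
proof (rule ballI, rule ccontr)
  fix m assume m: "m \<in> Poly_Mapping.keys (kdiff \<omega> S)" and ne: "int (monom_degree m) \<noteq> e"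
  have "Poly_Mapping.lookup (kdiff \<omega> S) m = 0"
    unfolding lookup_kdiff
  proof (intro sum.neutral ballI)
    fix s
    show "(if 0 < Poly_Mapping.lookup m s then
        eps s S * Poly_Mapping.lookup (\<omega> (insert s S)) (m - Poly_Mapping.single s 1) else 0) = 0"
      using monom_degree_diff_single[of m s] ne lookup_homogeneous[OF assms] by simp
  qed
  then show False using m by (simp add: in_keys_iff)
qed

lemma kdiff_minus: "kdiff (\<lambda>S. \<omega> S - \<tau> S) S = kdiff \<omega> S - kdiff \<tau> S"
  unfolding kdiff_def by (simp add: right_diff_distrib sum_subtractf)

lemma kdiff_cong:
  "(\<And>s. s \<notin> S \<Longrightarrow> \<omega> (insert s S) = \<tau> (insert s S)) \<Longrightarrow> kdiff \<omega> S = kdiff \<tau> S"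
  unfolding kdiff_def by (intro sum.cong) auto

lemma edge_ideal_local:
  fixes \<eta> :: "'v::finite set \<Rightarrow> ('v, 'k::comm_ring_1) mpoly"
  assumes E: "simple_graph E" and gf: "gap_free E" and p: "0 < p" "p \<le> 5"
    and cycle: "\<And>S m. Suc (card S) = p \<Longrightarrow> stable_set E (Poly_Mapping.keys m) \<Longrightarrow>
      Poly_Mapping.lookup (kdiff \<eta> S) m = 0"
    and deg: "monom_degree \<alpha> = p + 3"
  shows "\<exists>c. \<forall>S m. card S = p \<longrightarrow> m + set_monom S = \<alpha> \<longrightarrow> stable_set E (Poly_Mapping.keys m) \<longrightarrow>
      Poly_Mapping.lookup (\<eta> S) m =
        (\<Sum>s\<in>-S. if 0 < Poly_Mapping.lookup m s then eps s S * c (insert s S) else 0)"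
proof (cases "\<exists>v. Poly_Mapping.lookup \<alpha> v \<ge> 2")
  case True
  then obtain v where v: "Poly_Mapping.lookup \<alpha> v \<ge> 2" by blast
  show ?thesis
  proof (rule koszul_homotopy[where v = v])
    fix S :: "'v set" and m :: "'v \<Rightarrow>\<^sub>0 nat" assume "m + set_monom S = \<alpha>" "v \<in> S" and st: "stable_set E (Poly_Mapping.keys m)"
    \<comment> \<open>\<open>S\<close> uses \<open>v\<close> only once, so \<open>m\<close> still
      contains it, and a further factor x_v does not change the support.\<close>
    then have "Poly_Mapping.lookup m v \<ge> 1" using v by (auto simp: lookup_add lookup_set_monom)
    then have "Poly_Mapping.keys (m + Poly_Mapping.single v 1) = Poly_Mapping.keys m"
      by (auto simp: keys_add_nat in_keys_iff)
    then show "stable_set E (Poly_Mapping.keys (m + Poly_Mapping.single v 1))" using st by simp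
  qed (use v cycle in auto)
next
  case False
  define W where "W = Poly_Mapping.keys \<alpha>"
  have small: "Poly_Mapping.lookup \<alpha> v < 2" for v using False by (meson not_le)
  have \<alpha>: "\<alpha> = set_monom W"
  proof (rule poly_mapping_eqI)
    fix v show "Poly_Mapping.lookup \<alpha> v = Poly_Mapping.lookup (set_monom W) v"
      using small[of v] by (auto simp: W_def lookup_set_monom in_keys_iff)
  qed
  then have cW: "card W = p + 3" using deg by simp
  \<comment> \<open>The bound \<open>p \<le> 5\<close> leaves at most eight vertices.\<close>
  then have "cohomology_vanishes (TYPE('k)) E 3 W" using p by (intro H2_vanishes_small[OF E gf]) simp
  \<comment> \<open>By \<open>eps_Diff\<close>, the Koszul sign at \<open>W - T\<close> and the
    coboundary sign at \<open>T\<close> differ by \<open>eps s W\<close>. The product over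
    \<open>T\<close> absorbs these factors, so that \<open>f\<close> below becomes a cochain for
    \<open>cobdry\<close>.\<close>
  moreover define K where "K T = (\<Prod>t\<in>T. eps t W :: 'k)" for T
  moreover have K_sq: "K T * K T = 1" for T by (simp add: K_def flip: prod.distrib)
  have K_remove: "K T = eps s W * K (T - {s})" if "s \<in> T" for s T
    using that by (simp add: K_def prod.remove)
  moreover define f where "f T = K T * Poly_Mapping.lookup (\<eta> (W - T)) (set_monom T)" for T
  have rest: "set_monom T - Poly_Mapping.single s 1 = set_monom (T - {s})" if "s \<in> T" for s and T :: "'v set"
    using that by (intro poly_mapping_eqI) (auto simp: lookup_minus lookup_set_monom lookup_single when_def)
  have to_T: "(\<Sum>s\<in>-(W - T). if 0 < Poly_Mapping.lookup (set_monom T) s then h s else 0) = (\<Sum>s\<in>T. h s)"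
    if "T \<subseteq> W" for T and h :: "'v \<Rightarrow> 'k"
  proof -
    have "(\<Sum>s\<in>-(W - T). if 0 < Poly_Mapping.lookup (set_monom T) s then h s else 0) =
       (\<Sum>s\<in>T. if 0 < Poly_Mapping.lookup (set_monom T) s then h s else 0)"
      by (rule sum.mono_neutral_right) (auto simp: lookup_set_monom)
    then show ?thesis by (simp add: lookup_set_monom)
  qed
  have W_minus: "insert s (W - T) = W - (T - {s})" if "s \<in> T" "T \<subseteq> W" for s T
    using that by auto
  have f_cocycle: "cobdry f T = 0" if T: "T \<subseteq> W" "stable_set E T" "card T = Suc 3" for T
  proof -
    \<comment> \<open>Faces with four vertices correspond to complements with \<open>p - 1\<close>
      elements, where the cycle condition is available.\<close>
    have "card (W - T) = p - 1" using T cW by (simp add: card_Diff_subset)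
    then have "0 = Poly_Mapping.lookup (kdiff \<eta> (W - T)) (set_monom T)"
      using cycle[of "W - T" "set_monom T"] p T by simp
    also have "\<dots> = (\<Sum>s\<in>T. eps s (W - T) *
        Poly_Mapping.lookup (\<eta> (insert s (W - T))) (set_monom T - Poly_Mapping.single s 1))"
      unfolding lookup_kdiff by (rule to_T[OF T(1)])
    also have "\<dots> = (\<Sum>s\<in>T. K T * (eps s (T - {s}) * f (T - {s})))"
    proof (rule sum.cong[OF refl])
      fix s assume s: "s \<in> T"
      have "K T * (eps s (T - {s}) * f (T - {s})) = (K (T - {s}) * K (T - {s})) * (eps s W * eps s (T - {s}) *
          Poly_Mapping.lookup (\<eta> (W - (T - {s}))) (set_monom (T - {s})))"
        unfolding K_remove[OF s] f_def by (simp add: mult_ac)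
      then show "eps s (W - T) *
          Poly_Mapping.lookup (\<eta> (insert s (W - T))) (set_monom T - Poly_Mapping.single s 1) =
        K T * (eps s (T - {s}) * f (T - {s}))"
        unfolding K_sq rest[OF s] W_minus[OF s T(1)] eps_Diff[OF T(1) s] by simp
    qed
    also have "\<dots> = K T * cobdry f T" by (simp add: cobdry_def sum_distrib_left)
    finally have "K T * (K T * cobdry f T) = 0" by simp
    then show ?thesis using K_sq[of T] by (simp flip: mult.assoc)
  qed
  ultimately obtain g where g: "\<And>T. T \<subseteq> W \<Longrightarrow> stable_set E T \<Longrightarrow> card T = 3 \<Longrightarrow> f T = cobdry g T"
    unfolding cohomology_vanishes_def by blast
  \<comment> \<open>The primitive, carried back to complements with the same sign
    correction.\<close>
  define c where "c U = K (W - U) * g (W - U)" for U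
  have "Poly_Mapping.lookup (\<eta> S) m =
        (\<Sum>s\<in>-S. if 0 < Poly_Mapping.lookup m s then eps s S * c (insert s S) else 0)"
    if S: "card S = p" and m: "m + set_monom S = \<alpha>" and st: "stable_set E (Poly_Mapping.keys m)" for S m
  proof -
    have SW: "S \<subseteq> W" unfolding W_def m[symmetric] by (simp add: keys_add_nat)
    define T where "T = W - S"
    have T: "T \<subseteq> W" "S = W - T" using SW by (auto simp: T_def)
    have mT: "m = set_monom T"
    proof (rule poly_mapping_eqI)
      fix v
      have "Poly_Mapping.lookup m v + Poly_Mapping.lookup (set_monom S) v = Poly_Mapping.lookup (set_monom W) v"
        using m unfolding \<alpha> by (metis lookup_add)
      then show "Poly_Mapping.lookup m v = Poly_Mapping.lookup (set_monom T) v"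
        using SW by (auto simp: lookup_set_monom T_def split: if_splits)
    qed
    have "card T = 3" using S cW SW by (simp add: T_def card_Diff_subset)
    then have fT: "f T = cobdry g T" using g[OF T(1)] st mT by simp
    have "(\<Sum>s\<in>-S. if 0 < Poly_Mapping.lookup m s then eps s S * c (insert s S) else 0) =
        (\<Sum>s\<in>T. eps s (W - T) * c (insert s (W - T)))"
      unfolding mT T(2) by (rule to_T[OF T(1)])
    also have "\<dots> = (\<Sum>s\<in>T. K T * (eps s (T - {s}) * g (T - {s})))"
    proof (rule sum.cong[OF refl])
      fix s assume s: "s \<in> T"
      have "W - (W - (T - {s})) = T - {s}" using T(1) by auto
      then show "eps s (W - T) * c (insert s (W - T)) = K T * (eps s (T - {s}) * g (T - {s}))"
        unfolding W_minus[OF s T(1)] eps_Diff[OF T(1) s] c_def K_remove[OF s] by (simp add: mult_ac)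
    qed
    also have "\<dots> = K T * f T" by (simp add: fT cobdry_def sum_distrib_left)
    also have "\<dots> = Poly_Mapping.lookup (\<eta> S) m"
      unfolding f_def mT T(2)[symmetric] using K_sq[of T] by (simp flip: mult.assoc)
    finally show ?thesis by simp
  qed
  then show ?thesis by blast
qed

text \<open>A cycle modulo the ideal is a boundary \<open>kdiff \<theta>\<close> modulo the ideal;
  subtracting that boundary moves the chain into the ideal and leaves its own differential
  unchanged. This is the lifted form of vanishing Koszul homology that dimension shifting
  uses.\<close>

lemma edge_ideal_koszul:
  fixes \<eta> :: "'v::finite set \<Rightarrow> ('v, 'k::comm_ring_1) mpoly"
  assumes E: "simple_graph E" and gf: "gap_free E" and p: "0 < p" "p \<le> 5"
    and hom: "\<And>S. homogeneous 3 (\<eta> S)" and zero: "\<And>S. card S \<noteq> p \<Longrightarrow> \<eta> S = 0"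
    and bd: "\<And>S. Suc (card S) = p \<Longrightarrow> kdiff \<eta> S \<in> edge_ideal E"
  obtains \<eta>' where "\<And>S. homogeneous 3 (\<eta>' S)" "\<And>S. card S \<noteq> p \<Longrightarrow> \<eta>' S = 0"
    "\<And>S. \<eta>' S \<in> edge_ideal E" "\<And>S. kdiff \<eta>' S = kdiff \<eta> S"
proof -
  obtain \<theta> where \<theta>: "\<And>T. homogeneous (3 - 1) (\<theta> T)" "\<And>T. card T \<noteq> Suc p \<Longrightarrow> \<theta> T = 0"
    "\<And>S m. card S = p \<Longrightarrow> stable_set E (Poly_Mapping.keys m) \<Longrightarrow>
       Poly_Mapping.lookup (kdiff \<theta> S) m = Poly_Mapping.lookup (\<eta> S) m"
  proof (rule koszul_assemble[of p 3 \<eta> "\<lambda>m. stable_set E (Poly_Mapping.keys m)"])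
    fix \<alpha> :: "'v \<Rightarrow>\<^sub>0 nat" assume \<alpha>: "int (monom_degree \<alpha>) = int p + 3"
    show "\<exists>c. \<forall>S m. card S = p \<longrightarrow> m + set_monom S = \<alpha> \<longrightarrow> stable_set E (Poly_Mapping.keys m) \<longrightarrow>
      Poly_Mapping.lookup (\<eta> S) m =
        (\<Sum>s\<in>-S. if 0 < Poly_Mapping.lookup m s then eps s S * c (insert s S) else 0)"
    proof (rule edge_ideal_local[OF E gf p])
      fix S :: "'v set" and m :: "'v \<Rightarrow>\<^sub>0 nat" assume "Suc (card S) = p" "stable_set E (Poly_Mapping.keys m)"
      moreover from this have "kdiff \<eta> S \<in> edge_ideal E" by (intro bd) simp
      ultimately have "m \<notin> Poly_Mapping.keys (kdiff \<eta> S)" by (auto simp: mem_edge_ideal_iff[OF E])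
      then show "Poly_Mapping.lookup (kdiff \<eta> S) m = 0" by (simp add: in_keys_iff)
    qed (use \<alpha> in simp)
  qed (rule hom, rule that)
  have 0: "kdiff \<theta> S = 0" if "card S \<noteq> p" for S
    unfolding kdiff_def using that \<theta>(2) by (intro sum.neutral) auto
  show thesis
  proof (rule that[of "\<lambda>S. \<eta> S - kdiff \<theta> S"])
    fix S :: "'v set"
    show "homogeneous 3 (\<eta> S - kdiff \<theta> S)" by (intro homogeneous_diff hom homogeneous_kdiff \<theta>(1))
    show "\<eta> S - kdiff \<theta> S = 0" if "card S \<noteq> p" using zero 0 that by simp
    show "\<eta> S - kdiff \<theta> S \<in> edge_ideal E"
      using \<theta>(3)[of S] 0[of S] zero[of S]
      by (cases "card S = p") (auto simp: mem_edge_ideal_iff[OF E] in_keys_iff lookup_minus)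
    show "kdiff (\<lambda>S. \<eta> S - kdiff \<theta> S) S = kdiff \<eta> S"
      by (simp add: kdiff_minus kdiff_kdiff)
  qed
qed

lemma stable_pair:
  assumes "simple_graph E" "{s, t} \<notin> E"
  shows "stable_set E {s, t}"
proof (rule ccontr)
  assume "\<not> stable_set E {s, t}"
  then obtain a b where "a \<in> {s, t}" "b \<in> {s, t}" "a \<noteq> b" "{a, b} \<in> E"
    using not_stableE[OF assms(1)] by metis
  then show False using assms(2) by (auto simp: insert_commute)
qed

text \<open>
  A gap \<open>{x, y}, {z, w}\<close> yields the Koszul cycle \<open>x\<^sub>y x\<^sub>w e\<^sub>x \<and> e\<^sub>z\<close> of \<open>R/I\<close>. In this
  multidegree the complex computes the cohomology of a 4-cycle, so the cycle is not a boundary.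
\<close>

lemma gap_free_if_koszul:
  fixes E :: "'v::finite set set"
  assumes E: "simple_graph E"
    and van: "\<And>\<eta> :: 'v set \<Rightarrow> ('v, 'k::comm_ring_1) mpoly.
      (\<And>S. homogeneous 2 (\<eta> S)) \<Longrightarrow> (\<And>S. card S \<noteq> 2 \<Longrightarrow> \<eta> S = 0) \<Longrightarrow>
      (\<And>S. card S = 1 \<Longrightarrow> kdiff \<eta> S \<in> edge_ideal E) \<Longrightarrow>
      \<exists>\<eta>'. (\<forall>S. homogeneous 2 (\<eta>' S)) \<and> (\<forall>S. \<eta>' S \<in> edge_ideal E) \<and>
        (\<forall>S. card S = 1 \<longrightarrow> kdiff \<eta>' S = kdiff \<eta> S)"
  shows "gap_free E"
proof (rule ccontr)
  assume "\<not> gap_free E"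
  then obtain x y z w where xy: "{x, y} \<in> E" and zw: "{z, w} \<in> E" and disj: "{x, y} \<inter> {z, w} = {}"
    and cross: "{x, z} \<notin> E" "{x, w} \<notin> E" "{y, z} \<notin> E" "{y, w} \<notin> E"
    unfolding gap_free_def by blast
  have "card {x, y} = 2" "card {z, w} = 2"
    using E xy zw unfolding simple_graph_def by blast+
  then have "x \<noteq> y" "z \<noteq> w" by auto
  then have ne: "x \<noteq> y" "z \<noteq> w" "x \<noteq> z" "x \<noteq> w" "y \<noteq> z" "y \<noteq> w"
    using disj by auto
  define \<eta> :: "'v set \<Rightarrow> ('v, 'k) mpoly" where
    "\<eta> S = (if S = {x, z} then Poly_Mapping.single (set_monom {y, w}) 1 else 0)" for S
  have "\<exists>\<eta>'. (\<forall>S. homogeneous 2 (\<eta>' S)) \<and> (\<forall>S. \<eta>' S \<in> edge_ideal E) \<and>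
        (\<forall>S. card S = 1 \<longrightarrow> kdiff \<eta>' S = kdiff \<eta> S)"
  proof (rule van)
    fix S :: "'v set"
    show "homogeneous 2 (\<eta> S)" using ne by (simp add: \<eta>_def homogeneous_def)
    show "\<eta> S = 0" if "card S \<noteq> 2" using that ne by (auto simp: \<eta>_def)
    show "kdiff \<eta> S \<in> edge_ideal E"
      unfolding mem_edge_ideal_iff[OF E]
    proof (intro ballI notI)
      fix m assume m: "m \<in> Poly_Mapping.keys (kdiff \<eta> S)" and st: "stable_set E (Poly_Mapping.keys m)"
      have "(\<Sum>s\<in>-S. if 0 < Poly_Mapping.lookup m s then
          eps s S * Poly_Mapping.lookup (\<eta> (insert s S)) (m - Poly_Mapping.single s 1) else 0) \<noteq> 0"
        using m unfolding in_keys_iff lookup_kdiff .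
      then obtain s where "(if 0 < Poly_Mapping.lookup m s then
          eps s S * Poly_Mapping.lookup (\<eta> (insert s S)) (m - Poly_Mapping.single s 1) else 0) \<noteq> 0"
        by (rule sum.not_neutral_contains_not_neutral)
      then have s: "0 < Poly_Mapping.lookup m s"
          "Poly_Mapping.lookup (\<eta> (insert s S)) (m - Poly_Mapping.single s 1) \<noteq> 0"
        by (auto split: if_splits)
      then have ins: "insert s S = {x, z}" and "m - Poly_Mapping.single s 1 = set_monom {y, w}"
        by (auto simp: \<eta>_def lookup_single when_def split: if_splits)
      then have "m = set_monom {y, w} + Poly_Mapping.single s 1"
        using diff_single_add[OF s(1)] by simp
      then have "Poly_Mapping.keys m = {y, w, s}" by (auto simp: keys_add_nat)
      moreover have "s = x \<or> s = z" using ins by auto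
      ultimately have "{x, y} \<subseteq> Poly_Mapping.keys m \<or> {z, w} \<subseteq> Poly_Mapping.keys m" by auto
      then show False using st xy zw unfolding stable_set_def by blast
    qed
  qed
  then obtain \<eta>' where \<eta>': "\<And>S. homogeneous 2 (\<eta>' S)" "\<And>S. \<eta>' S \<in> edge_ideal E"
    "\<And>S. card S = 1 \<Longrightarrow> kdiff \<eta>' S = kdiff \<eta> S" by blast
  \<comment> \<open>\<open>\<eta>\<close> and \<open>\<eta>'\<close> have the same differential, so
    over the polynomial ring they differ by a boundary. At monomials of stable support
    \<open>\<eta>'\<close> is invisible.\<close>
  obtain \<theta> where \<theta>: "\<And>S. card S = 2 \<Longrightarrow> kdiff \<theta> S = \<eta> S - \<eta>' S"
  proof (rule koszul_exact[of 2 2 "\<lambda>S. \<eta> S - \<eta>' S"])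
    fix S :: "'v set"
    have "homogeneous 2 (\<eta> S)" using ne by (simp add: \<eta>_def homogeneous_def)
    then show "homogeneous 2 (\<eta> S - \<eta>' S)" by (intro homogeneous_diff \<eta>')
    show "kdiff (\<lambda>S. \<eta> S - \<eta>' S) S = 0" if "Suc (card S) = 2"
      using \<eta>'(3)[of S] that by (simp add: kdiff_minus)
  qed (auto intro: that)
  define W where "W = {x, y, z, w}"
  \<comment> \<open>A 0-cochain on the four vertices. By \<open>key\<close>, its coboundary along a
    non-edge \<open>{s, t}\<close> is, up to sign, the coefficient of \<open>\<eta>\<close> at the
    complementary pair.\<close>
  define K where "K t = eps t W * Poly_Mapping.lookup (\<theta> (W - {t})) (Poly_Mapping.single t 1)" for t
  have key: "K t - K s = eps s {t} * (eps s W * (eps t W * Poly_Mapping.lookup (\<eta> (W - {s, t})) (set_monom {s, t})))"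
    if st: "s \<in> W" "t \<in> W" "s \<noteq> t" "{s, t} \<notin> E" for s t
  proof -
    let ?S = "W - {s, t}"
    have "card W = 4" using ne by (simp add: W_def)
    then have "card ?S = 2" using st by (simp add: card_Diff_subset)
    moreover have "Poly_Mapping.lookup (\<eta>' ?S) (set_monom {s, t}) = 0"
    proof (rule ccontr)
      assume "Poly_Mapping.lookup (\<eta>' ?S) (set_monom {s, t}) \<noteq> 0"
      then have "set_monom {s, t} \<in> Poly_Mapping.keys (\<eta>' ?S)" by (simp add: in_keys_iff)
      then have "\<not> stable_set E (Poly_Mapping.keys (set_monom {s, t}))"
        using \<eta>'(2)[of ?S] unfolding mem_edge_ideal_iff[OF E] by (rule bspec[rotated])
      then show False using stable_pair[OF E st(4)] by simp
    qed
    ultimately have "Poly_Mapping.lookup (\<eta> ?S) (set_monom {s, t}) =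
        Poly_Mapping.lookup (kdiff \<theta> ?S) (set_monom {s, t})"
      by (simp add: \<theta> lookup_minus)
    also have "\<dots> = (\<Sum>u\<in>{s, t}. eps u ?S *
        Poly_Mapping.lookup (\<theta> (insert u ?S)) (set_monom {s, t} - Poly_Mapping.single u 1))"
      unfolding lookup_kdiff by (rule sum.mono_neutral_cong_right) (auto simp: lookup_set_monom)
    also have "\<dots> = eps s ?S * Poly_Mapping.lookup (\<theta> (W - {t})) (Poly_Mapping.single t 1) +
        eps t ?S * Poly_Mapping.lookup (\<theta> (W - {s})) (Poly_Mapping.single s 1)"
    proof -
      have "insert s ?S = W - {t}" "insert t ?S = W - {s}" using st by auto
      moreover have "set_monom {s, t} - Poly_Mapping.single s 1 = Poly_Mapping.single t 1"
        "set_monom {s, t} - Poly_Mapping.single t 1 = Poly_Mapping.single s 1"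
        using st(3) by (simp_all add: set_monom_def add.commute)
      ultimately show ?thesis using st(3) by simp
    qed
    also have "eps s ?S = eps s W * (eps s {t} :: 'k)"
      using eps_Diff[of "{s, t}" W s, where 'a='k] st by (simp add: insert_Diff_if)
    also have "eps t ?S = - (eps t W * (eps s {t} :: 'k))"
    proof -
      have "eps s {t} * (eps s {t} * eps t {s}) = - (eps s {t} :: 'k)"
        using eps_insert_insert[OF st(3), of "{}", where 'b='k] by simp
      then have "eps t {s} = - (eps s {t} :: 'k)" by simp
      moreover have "eps t ?S = (eps t W * eps t {s} :: 'k)"
        using eps_Diff[of "{s, t}" W t, where 'a='k] st by (simp add: insert_Diff_if)
      ultimately show ?thesis by simp
    qed
    finally have *: "Poly_Mapping.lookup (\<eta> ?S) (set_monom {s, t}) =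
        eps s W * eps s {t} * Poly_Mapping.lookup (\<theta> (W - {t})) (Poly_Mapping.single t 1) -
        eps t W * eps s {t} * Poly_Mapping.lookup (\<theta> (W - {s})) (Poly_Mapping.single s 1)" by simp
    have canc: "eps t W * (eps s {t} * (eps s W * (eps t W * (c :: 'k)))) = eps s {t} * (eps s W * c)" for c
      by (metis eps_cancel mult.left_commute)
    show ?thesis unfolding * K_def
      by (simp add: right_diff_distrib mult_ac)
  qed
  have eq: "K t = K s" if "s \<in> W" "t \<in> W" "s \<noteq> t" "{s, t} \<notin> E" "W - {s, t} \<noteq> {x, z}" for s t
    using key[OF that(1-4)] that(5) by (simp add: \<eta>_def)
  have "W - {y, z} = {x, w}" "W - {x, z} = {y, w}" "W - {x, w} = {y, z}" and yw: "W - {y, w} = {x, z}"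
    using ne by (auto simp: W_def)
  \<comment> \<open>Three sides of the 4-cycle y, z, x, w force \<open>K\<close> to be constant,
    while the side from \<open>w\<close> to \<open>y\<close> demands a difference of 1 or
    -1.\<close>
  then have "K z = K y" "K z = K x" "K w = K x"
    using ne cross by (intro eq; simp add: W_def doubleton_eq_iff)+
  then have "eps y {w} * (eps y W * (eps w W * (1 :: 'k))) = 0"
    using key[of y w] ne cross yw by (simp add: W_def \<eta>_def)
  then show False by (metis eps_cancel mult_zero_right zero_neq_one)
qed

section \<open>Dimension shifting along a minimal resolution\<close>

lemma homogeneous_sum:
  assumes "\<And>x. x \<in> A \<Longrightarrow> homogeneous e (f x)"
  shows "homogeneous e (sum f A)"
  unfolding homogeneous_def
proof (rule ballI, rule ccontr)
  fix m assume m: "m \<in> Poly_Mapping.keys (sum f A)" and ne: "int (monom_degree m) \<noteq> e"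
  have "Poly_Mapping.lookup (sum f A) m = 0"
    unfolding lookup_sum using lookup_homogeneous[OF assms ne] by (rule sum.neutral[OF ballI])
  then show False using m by (simp add: in_keys_iff)
qed

lemma homogeneous_mult:
  assumes "homogeneous a p" "homogeneous b q"
  shows "homogeneous (a + b) (p * q)"
  unfolding homogeneous_def
proof
  fix m assume "m \<in> Poly_Mapping.keys (p * q)"
  then obtain k l where "m = k + l" "k \<in> Poly_Mapping.keys p" "l \<in> Poly_Mapping.keys q"
    using keys_mult[of p q] by blast
  then show "int (monom_degree m) = a + b"
    using assms by (simp add: homogeneous_def monom_degree_add)
qed

text \<open>The resolution is exact on arbitrary vectors; passing to homogeneous parts makes the
  preimages graded.\<close>

definition hpart :: "int \<Rightarrow> ('v::finite, 'k::zero) mpoly \<Rightarrow> ('v, 'k) mpoly" where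
  "hpart e p = Abs_poly_mapping (\<lambda>m. if int (monom_degree m) = e then Poly_Mapping.lookup p m else 0)"

lemma lookup_hpart:
  "Poly_Mapping.lookup (hpart e p) m = (if int (monom_degree m) = e then Poly_Mapping.lookup p m else 0)"
proof -
  have "finite {m. (if int (monom_degree m) = e then Poly_Mapping.lookup p m else 0) \<noteq> 0}"
    by (rule finite_subset[OF _ finite_keys[of p]]) (auto simp: in_keys_iff)
  then show ?thesis by (simp add: hpart_def)
qed

lemma homogeneous_hpart: "homogeneous e (hpart e p)"
  by (auto simp: homogeneous_def in_keys_iff lookup_hpart split: if_splits)

lemma hpart_id: "homogeneous e p \<Longrightarrow> hpart e p = p"
  by (rule poly_mapping_eqI) (auto simp: lookup_hpart lookup_homogeneous)

lemma hpart_sum: "hpart e (sum f A) = (\<Sum>x\<in>A. hpart e (f x))"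
proof (rule poly_mapping_eqI)
  fix m show "Poly_Mapping.lookup (hpart e (sum f A)) m = Poly_Mapping.lookup (\<Sum>x\<in>A. hpart e (f x)) m"
    by (cases "int (monom_degree m) = e") (simp_all add: lookup_hpart lookup_sum)
qed

lemma hpart_mult:
  fixes p q :: "('v::finite, 'k::comm_ring_1) mpoly"
  assumes p: "homogeneous a p"
  shows "hpart e (p * q) = p * hpart (e - a) q"
proof (rule poly_mapping_eqI)
  fix m
  let ?r = "q - hpart (e - a) q"
  have "homogeneous e (p * hpart (e - a) q)"
    using homogeneous_mult[OF p homogeneous_hpart[of "e - a" q]] by simp
  moreover have "Poly_Mapping.lookup (p * ?r) m = 0" if "int (monom_degree m) = e"
  proof (rule ccontr)
    assume "Poly_Mapping.lookup (p * ?r) m \<noteq> 0"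
    then have "m \<in> Poly_Mapping.keys (p * ?r)" by (simp add: in_keys_iff)
    then obtain k l where "m = k + l" "k \<in> Poly_Mapping.keys p" "l \<in> Poly_Mapping.keys ?r"
      using keys_mult[of p ?r] by blast
    then show False using that p
      by (auto simp: homogeneous_def monom_degree_add in_keys_iff lookup_minus lookup_hpart split: if_splits)
  qed
  moreover have "p * q = p * hpart (e - a) q + p * ?r" by (simp add: algebra_simps)
  then have "Poly_Mapping.lookup (p * q) m =
      Poly_Mapping.lookup (p * hpart (e - a) q) m + Poly_Mapping.lookup (p * ?r) m"
    by (simp only: lookup_add)
  ultimately show "Poly_Mapping.lookup (hpart e (p * q)) m = Poly_Mapping.lookup (p * hpart (e - a) q) m"
    using lookup_homogeneous by (auto simp: lookup_hpart)
qed

lemma monom_degree_0 [simp]: "monom_degree 0 = 0"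
  by (simp add: monom_degree_def)

lemma add_single_neq_0: "m + Poly_Mapping.single (v :: 'v::finite) (1 :: nat) \<noteq> 0"
proof
  assume "m + Poly_Mapping.single v (1 :: nat) = 0"
  then have "monom_degree (m + Poly_Mapping.single v 1) = 0" by (simp only: monom_degree_0)
  then show False by (simp add: monom_degree_add)
qed

text \<open>Minimality enters in this form: the matrix entries have no constant term.\<close>

lemma lookup_irrelevant_ideal:
  fixes p :: "('v::finite, 'k::comm_ring_1) mpoly"
  assumes "p \<in> irrelevant_ideal"
  shows "Poly_Mapping.lookup p 0 = 0"
proof -
  interpret M: Modules.module "(*) :: ('v, 'k) mpoly \<Rightarrow> _" by (rule module_times)
  have zero: "a = 0 \<and> b = 0" if "a + b = 0" for a b :: "'v \<Rightarrow>\<^sub>0 nat"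
  proof -
    have "Poly_Mapping.lookup a v + Poly_Mapping.lookup b v = 0" for v
      using arg_cong[OF that, of "\<lambda>m. Poly_Mapping.lookup m v"] by (simp add: lookup_add)
    then show ?thesis by (auto intro!: poly_mapping_eqI)
  qed
  have "M.span (range var) \<subseteq> {p. 0 \<notin> Poly_Mapping.keys p}"
  proof (rule M.span_minimal)
    show "range var \<subseteq> {p :: ('v, 'k) mpoly. 0 \<notin> Poly_Mapping.keys p}"
    proof clarify
      fix v assume "0 \<in> Poly_Mapping.keys (var v :: ('v, 'k) mpoly)"
      then have "Poly_Mapping.single v (1 :: nat) = 0" by (simp add: var_def split: if_splits)
      then show False using add_single_neq_0[of 0 v] by simp
    qed
    show "M.subspace {p. 0 \<notin> Poly_Mapping.keys p}"
    proof (rule M.subspaceI)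
      fix x y :: "('v, 'k) mpoly"
      assume "x \<in> {p. 0 \<notin> Poly_Mapping.keys p}" "y \<in> {p. 0 \<notin> Poly_Mapping.keys p}"
      then show "x + y \<in> {p. 0 \<notin> Poly_Mapping.keys p}" using keys_add[of x y] by blast
    next
      fix c x :: "('v, 'k) mpoly"
      assume x: "x \<in> {p. 0 \<notin> Poly_Mapping.keys p}"
      have "0 \<notin> Poly_Mapping.keys (c * x)"
      proof
        assume "0 \<in> Poly_Mapping.keys (c * x)"
        then obtain a b where "0 = a + b" "b \<in> Poly_Mapping.keys x" using keys_mult[of c x] by blast
        then show False using zero[of a b] x by simp
      qed
      then show "c * x \<in> {p. 0 \<notin> Poly_Mapping.keys p}" by simp
    qed simp
  qed
  then show ?thesis using assms unfolding irrelevant_ideal_def ideal_generated_def by (auto simp: in_keys_iff)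
qed

lemma lookup_kdiff_0 [simp]: "Poly_Mapping.lookup (kdiff \<omega> S) 0 = 0"
  by (simp add: lookup_kdiff)

text \<open>The end of the Koszul complex, whose cokernel is the residue field: the contraction by a
  variable fails only at the monomial 1.\<close>

lemma kdiff_onto:
  fixes p :: "('v::finite, 'k::comm_ring_1) mpoly"
  assumes hom: "homogeneous e p" and "Poly_Mapping.lookup p 0 = 0"
  obtains \<theta> where "\<And>T. homogeneous (e - 1) (\<theta> T)" "\<And>T. card T \<noteq> 1 \<Longrightarrow> \<theta> T = 0" "kdiff \<theta> {} = p"
proof -
  have nz: "\<exists>v. 0 < Poly_Mapping.lookup \<alpha> v" if "\<alpha> \<noteq> 0" for \<alpha> :: "'v \<Rightarrow>\<^sub>0 nat"
    using that by (metis gr0I lookup_zero poly_mapping_eqI)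
  obtain \<theta> where \<theta>: "\<And>T. homogeneous (e - 1) (\<theta> T)" "\<And>T. card T \<noteq> Suc 0 \<Longrightarrow> \<theta> T = 0"
    "\<And>S m. card S = 0 \<Longrightarrow> m \<noteq> 0 \<Longrightarrow> Poly_Mapping.lookup (kdiff \<theta> S) m = Poly_Mapping.lookup p m"
  proof (rule koszul_assemble[of 0 e "\<lambda>_. p" "\<lambda>m. m \<noteq> 0"])
    fix \<alpha> :: "'v \<Rightarrow>\<^sub>0 nat"
    show "\<exists>c. \<forall>S m. card S = 0 \<longrightarrow> m + set_monom S = \<alpha> \<longrightarrow> m \<noteq> 0 \<longrightarrow> Poly_Mapping.lookup p m =
        (\<Sum>s\<in>-S. if 0 < Poly_Mapping.lookup m s then eps s S * c (insert s S) else 0)"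
    proof (cases "\<alpha> = 0")
      case True
      then show ?thesis by (auto simp: set_monom_def)
    next
      case False
      then obtain v where v: "0 < Poly_Mapping.lookup \<alpha> v" using nz by blast
      show ?thesis
      proof (rule koszul_homotopy[OF v])
        fix m :: "'v \<Rightarrow>\<^sub>0 nat"
        show "m + Poly_Mapping.single v 1 \<noteq> 0"
          by (rule add_single_neq_0)
      qed simp
    qed
  qed (rule hom, rule that)
  have "kdiff \<theta> {} = p"
  proof (rule poly_mapping_eqI)
    fix m show "Poly_Mapping.lookup (kdiff \<theta> {}) m = Poly_Mapping.lookup p m"
      using \<theta>(3)[of "{}" m] assms(2) by (cases "m = 0") auto
  qed
  then show thesis using that[of \<theta>] \<theta>(1,2) by simp
qed

section \<open>Koszul chains with values in free modules\<close>

type_synonym ('v, 'k) mpolys = "nat \<Rightarrow> ('v, 'k) mpoly"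

definition vdiff :: "('v::finite set \<Rightarrow> ('v, 'k::comm_ring_1) mpolys) \<Rightarrow> 'v set \<Rightarrow> ('v, 'k) mpolys" where
  "vdiff \<omega> S = (\<lambda>q. kdiff (\<lambda>T. \<omega> T q) S)"

text \<open>Vectors are padded with 0 to functions on \<open>nat\<close>, and chains are 0 off the
  sets of size \<open>p\<close>, so equations between chains can be stated for all sets and all
  indices.\<close>

definition koszul_chains :: "nat \<Rightarrow> ('v::finite, 'k::zero) mpolys set \<Rightarrow> ('v set \<Rightarrow> ('v, 'k) mpolys) set" where
  "koszul_chains p A = {\<omega>. \<forall>S. if card S = p then \<omega> S \<in> A else \<omega> S = (\<lambda>_. 0)}"

lemma chainsD: "\<omega> \<in> koszul_chains p A \<Longrightarrow> card S = p \<Longrightarrow> \<omega> S \<in> A"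
  "\<omega> \<in> koszul_chains p A \<Longrightarrow> card S \<noteq> p \<Longrightarrow> \<omega> S = (\<lambda>_. 0)"
  by (auto simp: koszul_chains_def split: if_splits)

lemma vdiff_vdiff: "vdiff (vdiff \<omega>) S = (\<lambda>_. 0)"
  by (simp add: vdiff_def kdiff_kdiff)

lemma vdiff_minus: "vdiff (\<lambda>S q. \<omega> S q - \<tau> S q) S = (\<lambda>q. vdiff \<omega> S q - vdiff \<tau> S q)"
  by (simp add: vdiff_def kdiff_minus)

lemma vdiff_cong:
  "(\<And>T. card T = Suc (card S) \<Longrightarrow> \<omega> T = \<tau> T) \<Longrightarrow> vdiff \<omega> S = vdiff \<tau> S"
  unfolding vdiff_def by (intro ext kdiff_cong) simp

lemma vdiff_0 [simp]: "vdiff (\<lambda>_ _. 0) S = (\<lambda>_. 0)"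
  by (simp add: vdiff_def kdiff_def)

lemma vdiff_chains_0:
  assumes "\<omega> \<in> koszul_chains p A" "Suc (card S) \<noteq> p"
  shows "vdiff \<omega> S = (\<lambda>_. 0)"
proof -
  have "vdiff \<omega> S = vdiff (\<lambda>_ _. 0) S"
    using assms by (intro vdiff_cong) (auto simp: chainsD(2))
  then show ?thesis by simp
qed

lemma chains_choose:
  assumes "\<omega> \<in> koszul_chains p (f ` A)" "f (\<lambda>_. 0) = (\<lambda>_. 0)"
  obtains \<xi> where "\<xi> \<in> koszul_chains p A" "\<And>S. f (\<xi> S) = \<omega> S"
proof -
  define \<xi> where "\<xi> S = (if card S = p then SOME u. u \<in> A \<and> f u = \<omega> S else (\<lambda>_. 0))" for S
  have \<xi>: "\<xi> S \<in> A \<and> f (\<xi> S) = \<omega> S" if "card S = p" for S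
  proof -
    have "\<exists>u. u \<in> A \<and> f u = \<omega> S" using chainsD(1)[OF assms(1) that] by auto
    then have "(SOME u. u \<in> A \<and> f u = \<omega> S) \<in> A \<and> f (SOME u. u \<in> A \<and> f u = \<omega> S) = \<omega> S"
      by (rule someI_ex)
    then show ?thesis using that by (simp add: \<xi>_def)
  qed
  show thesis
  proof (rule that)
    show "\<xi> \<in> koszul_chains p A" unfolding koszul_chains_def using \<xi> by (simp add: \<xi>_def)
    show "f (\<xi> S) = \<omega> S" for S
      using \<xi>[of S] chainsD(2)[OF assms(1), of S] assms(2) by (cases "card S = p") (auto simp: \<xi>_def)
  qed
qed

section \<open>Graded strands of a minimal resolution\<close>

locale minimal_resolution =
  fixes I :: "('v::finite, 'k::comm_ring_1) mpoly set"
    and d :: "nat \<Rightarrow> nat list" and D :: "nat \<Rightarrow> ('v, 'k) mpoly mat"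
  assumes resolution: "minimal_graded_free_resolution I d D"
begin

text \<open>The degree \<open>e\<close> part of F_i: the coordinate at a basis element of degree a
  has degree e - a.\<close>

definition component :: "nat \<Rightarrow> int \<Rightarrow> ('v, 'k) mpolys set" where
  "component i e = {w. \<forall>q. if q < length (d i) then homogeneous (e - int (d i ! q)) (w q) else w q = 0}"

definition app :: "nat \<Rightarrow> ('v, 'k) mpolys \<Rightarrow> ('v, 'k) mpolys" where
  "app i w = (\<lambda>p. if p < length (d i) then \<Sum>q<length (d (Suc i)). D i $$ (p, q) * w q else 0)"

lemma componentI:
  "(\<And>q. q < length (d i) \<Longrightarrow> homogeneous (e - int (d i ! q)) (w q)) \<Longrightarrow>
   (\<And>q. q \<ge> length (d i) \<Longrightarrow> w q = 0) \<Longrightarrow> w \<in> component i e"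
  by (simp add: component_def)

lemma componentD:
  "w \<in> component i e \<Longrightarrow> q < length (d i) \<Longrightarrow> homogeneous (e - int (d i ! q)) (w q)"
  "w \<in> component i e \<Longrightarrow> q \<ge> length (d i) \<Longrightarrow> w q = 0"
  unfolding component_def by (auto dest: spec[of _ q])

lemma d_0: "d 0 = [0]"
  using resolution by (simp add: minimal_graded_free_resolution_def)

lemma D_carrier: "D i \<in> carrier_mat (length (d i)) (length (d (Suc i)))"
  using resolution by (simp add: minimal_graded_free_resolution_def graded_map_def)

lemma D_homogeneous:
  assumes "p < length (d i)" "q < length (d (Suc i))"
  shows "homogeneous (int (d (Suc i) ! q) - int (d i ! p)) (D i $$ (p, q))"
proof -
  have "graded_map (d (Suc i)) (d i) (D i)"
    using resolution by (simp add: minimal_graded_free_resolution_def)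
  then have "\<forall>m\<in>Poly_Mapping.keys (D i $$ (p, q)). monom_degree m + d i ! p = d (Suc i) ! q"
    using assms by (simp add: graded_map_def)
  then show ?thesis unfolding homogeneous_def by force
qed

lemma D_no_constant:
  assumes "p < length (d i)" "q < length (d (Suc i))"
  shows "Poly_Mapping.lookup (D i $$ (p, q)) 0 = 0"
proof (rule lookup_irrelevant_ideal)
  have "D i $$ (p, q) \<in> elements_mat (D i)"
    using assms D_carrier[of i] by (intro elements_matI) auto
  then show "D i $$ (p, q) \<in> irrelevant_ideal"
    using resolution unfolding minimal_graded_free_resolution_def by blast
qed

lemma mult_vec_app: "D i *\<^sub>v vec (length (d (Suc i))) w = vec (length (d i)) (app i w)"
  using D_carrier[of i]
  by (intro eq_vecI) (auto simp: app_def scalar_prod_def atLeast0LessThan intro!: sum.cong)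

lemma app_0 [simp]: "app i (\<lambda>_. 0) = (\<lambda>_. 0)"
  by (simp add: app_def fun_eq_iff)

lemma app_minus: "app i (\<lambda>q. u q - w q) = (\<lambda>q. app i u q - app i w q)"
  by (simp add: app_def right_diff_distrib sum_subtractf fun_eq_iff)

text \<open>Matrices over the ring commute with multiplication by variables; these are the two
  differentials of a double complex.\<close>

lemma app_vdiff: "app i (vdiff \<omega> S) = vdiff (\<lambda>T. app i (\<omega> T)) S"
proof
  fix p
  show "app i (vdiff \<omega> S) p = vdiff (\<lambda>T. app i (\<omega> T)) S p"
  proof (cases "p < length (d i)")
    case True
    have "(\<Sum>q<length (d (Suc i)). \<Sum>s\<in>-S. D i $$ (p, q) * (eps s S * (var s * \<omega> (insert s S) q))) =
      (\<Sum>s\<in>-S. \<Sum>q<length (d (Suc i)). D i $$ (p, q) * (eps s S * (var s * \<omega> (insert s S) q)))"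
      by (rule sum.swap)
    then show ?thesis using True
      by (simp add: app_def vdiff_def kdiff_def sum_distrib_left mult.left_commute)
  next
    case False
    then show ?thesis by (simp add: app_def vdiff_def kdiff_def)
  qed
qed

lemma app_component: "w \<in> component (Suc i) e \<Longrightarrow> app i w \<in> component i e"
proof (rule componentI)
  fix p assume w: "w \<in> component (Suc i) e" and p: "p < length (d i)"
  have "homogeneous (e - int (d i ! p)) (D i $$ (p, q) * w q)" if q: "q < length (d (Suc i))" for q
    using homogeneous_mult[OF D_homogeneous[OF p q] componentD(1)[OF w q]] by simp
  then show "homogeneous (e - int (d i ! p)) (app i w p)"
    using p by (auto simp: app_def intro!: homogeneous_sum)
qed (simp add: app_def)

lemma component_minus:
  "u \<in> component i e \<Longrightarrow> w \<in> component i e \<Longrightarrow> (\<lambda>q. u q - w q) \<in> component i e"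
  by (intro componentI homogeneous_diff) (simp_all add: componentD)

lemma component_0 [simp]: "(\<lambda>_. 0) \<in> component i e"
  by (intro componentI) simp_all

lemma component_chains: "\<omega> \<in> koszul_chains p (component i e) \<Longrightarrow> \<omega> S \<in> component i e"
  by (cases "card S = p") (simp_all add: chainsD)

lemma component_vdiff:
  assumes "\<omega> \<in> koszul_chains p (component i (e - 1))"
  shows "vdiff \<omega> S \<in> component i e"
proof (rule componentI)
  fix q assume "q < length (d i)"
  then have "homogeneous (e - int (d i ! q) - 1) (\<omega> T q)" for T
    using componentD(1)[OF component_chains[OF assms, of T], of q] by (simp add: algebra_simps)
  then show "homogeneous (e - int (d i ! q)) (vdiff \<omega> S q)"
    unfolding vdiff_def by (rule homogeneous_kdiff)
next
  fix q assume "q \<ge> length (d i)"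
  then show "vdiff \<omega> S q = 0"
    using componentD(2)[OF component_chains[OF assms]] by (simp add: vdiff_def kdiff_def)
qed

lemma app_app: "app i (app (Suc i) w) = (\<lambda>_. 0)"
proof
  fix p
  let ?v = "vec (length (d (Suc (Suc i)))) w"
  have "D (Suc i) *\<^sub>v ?v \<in> mat_image (D (Suc i))"
    unfolding mat_image_def using D_carrier[of "Suc i"] by auto
  also have "mat_image (D (Suc i)) = mat_kernel (D i)"
    using resolution by (simp add: minimal_graded_free_resolution_def)
  finally have "D i *\<^sub>v (D (Suc i) *\<^sub>v ?v) = 0\<^sub>v (length (d i))"
    using D_carrier[of i] by (auto simp: mat_kernel_def)
  then have "vec (length (d i)) (app i (app (Suc i) w)) = 0\<^sub>v (length (d i))"
    unfolding mult_vec_app .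
  then have "p < length (d i) \<Longrightarrow> app i (app (Suc i) w) p = 0"
    by (metis index_vec index_zero_vec(1))
  then show "app i (app (Suc i) w) p = 0" by (cases "p < length (d i)") (auto simp: app_def)
qed

text \<open>The matrix is homogeneous, so suitable homogeneous parts of any preimage of a
  homogeneous vector form again a preimage.\<close>

lemma graded_lift:
  assumes w: "w \<in> component i e" and v: "\<And>p. p < length (d i) \<Longrightarrow> app i v p = w p"
  shows "w \<in> app i ` component (Suc i) e"
proof
  define u where "u q = (if q < length (d (Suc i)) then hpart (e - int (d (Suc i) ! q)) (v q) else 0)" for q
  show "u \<in> component (Suc i) e"
    by (rule componentI) (simp_all add: u_def homogeneous_hpart)
  show "w = app i u"
  proof
    fix p
    show "w p = app i u p"
    proof (cases "p < length (d i)")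
      case p: True
      have "w p = hpart (e - int (d i ! p)) (w p)" using componentD(1)[OF w p] by (simp add: hpart_id)
      also have "\<dots> = (\<Sum>q<length (d (Suc i)). hpart (e - int (d i ! p)) (D i $$ (p, q) * v q))"
        unfolding v[OF p, symmetric] by (simp add: app_def p hpart_sum)
      also have "\<dots> = (\<Sum>q<length (d (Suc i)). D i $$ (p, q) * u q)"
        by (intro sum.cong) (auto simp: u_def hpart_mult[OF D_homogeneous[OF p]])
      finally show ?thesis using p by (simp add: app_def)
    next
      case False
      then show ?thesis using componentD(2)[OF w] by (simp add: app_def)
    qed
  qed
qed

lemma kernel_app:
  assumes w: "w \<in> component (Suc i) e" and "app i w = (\<lambda>_. 0)"
  shows "w \<in> app (Suc i) ` component (Suc (Suc i)) e"
proof -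
  let ?w = "vec (length (d (Suc i))) w"
  have "D i *\<^sub>v ?w = 0\<^sub>v (length (d i))"
    unfolding mult_vec_app assms(2) by (intro eq_vecI) auto
  then have "?w \<in> mat_kernel (D i)"
    using D_carrier[of i] by (auto simp: mat_kernel_def)
  also have "mat_kernel (D i) = mat_image (D (Suc i))"
    using resolution by (simp add: minimal_graded_free_resolution_def)
  finally obtain v where v: "v \<in> carrier_vec (length (d (Suc (Suc i))))" "?w = D (Suc i) *\<^sub>v v"
    unfolding mat_image_def using D_carrier[of "Suc i"] by auto
  have "v = vec (length (d (Suc (Suc i)))) (\<lambda>q. v $ q)" using v(1) by (intro eq_vecI) auto
  then have "?w = vec (length (d (Suc i))) (app (Suc i) (\<lambda>q. v $ q))"
    using v(2) mult_vec_app by metis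
  then have "app (Suc i) (\<lambda>q. v $ q) p = w p" if "p < length (d (Suc i))" for p
    using that by (metis index_vec)
  then show ?thesis by (rule graded_lift[OF w])
qed

text \<open>Identifies the cokernel of \<open>D 0\<close> with R/I degree by degree, the link
  between the resolution and the ideal.\<close>

lemma image_app_0_iff:
  "w \<in> app 0 ` component (Suc 0) e \<longleftrightarrow> w \<in> component 0 e \<and> w 0 \<in> I"
proof -
  have I: "I = (\<lambda>v. v $ 0) ` mat_image (D 0)"
    using resolution by (simp add: minimal_graded_free_resolution_def)
  have len: "length (d 0) = 1" by (simp add: d_0)
  have "app 0 u 0 \<in> I" for u
  proof -
    have "app 0 u 0 = (D 0 *\<^sub>v vec (length (d (Suc 0))) u) $ 0"
      unfolding mult_vec_app len by simp
    then show ?thesis unfolding I mat_image_def using D_carrier[of 0] by auto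
  qed
  moreover have "w \<in> app 0 ` component (Suc 0) e" if w: "w \<in> component 0 e" "w 0 \<in> I"
  proof -
    obtain v where v: "v \<in> carrier_vec (length (d (Suc 0)))" "w 0 = (D 0 *\<^sub>v v) $ 0"
      using w(2) D_carrier[of 0] unfolding I mat_image_def by auto
    have "v = vec (length (d (Suc 0))) (\<lambda>q. v $ q)" using v(1) by (intro eq_vecI) auto
    then have "w 0 = vec (length (d 0)) (app 0 (\<lambda>q. v $ q)) $ 0" using v(2) mult_vec_app by metis
    then show ?thesis using w(1) len by (intro graded_lift[of _ _ _ "\<lambda>q. v $ q"]) auto
  qed
  ultimately show ?thesis using app_component by auto
qed

lemma vdiff_exact:
  assumes "p > 0" and \<eta>: "\<eta> \<in> koszul_chains p (component i e)"
    and cycle: "\<And>S. Suc (card S) = p \<Longrightarrow> vdiff \<eta> S = (\<lambda>_. 0)"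
  obtains \<theta> where "\<theta> \<in> koszul_chains (Suc p) (component i (e - 1))" "\<And>S. vdiff \<theta> S = \<eta> S"
proof -
  have "\<exists>\<theta>. (\<forall>T. homogeneous (e - int (d i ! q) - 1) (\<theta> T)) \<and> (\<forall>T. card T \<noteq> Suc p \<longrightarrow> \<theta> T = 0) \<and>
      (\<forall>S. card S = p \<longrightarrow> kdiff \<theta> S = \<eta> S q)" if q: "q < length (d i)" for q
  proof -
    have 1: "homogeneous (e - int (d i ! q)) (\<eta> S q)" for S
      using componentD(1)[OF component_chains[OF \<eta>] q] .
    have 2: "kdiff (\<lambda>S. \<eta> S q) S = 0" if "Suc (card S) = p" for S
      using fun_cong[OF cycle[OF that], of q] by (simp add: vdiff_def)
    show ?thesis by (rule koszul_exact[OF \<open>p > 0\<close> 1 2]) auto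
  qed
  then obtain \<Theta> where \<Theta>: "\<And>q T. q < length (d i) \<Longrightarrow> homogeneous (e - int (d i ! q) - 1) (\<Theta> q T)"
    "\<And>q T. q < length (d i) \<Longrightarrow> card T \<noteq> Suc p \<Longrightarrow> \<Theta> q T = 0"
    "\<And>q S. q < length (d i) \<Longrightarrow> card S = p \<Longrightarrow> kdiff (\<Theta> q) S = \<eta> S q" by metis
  define \<theta> where "\<theta> T q = (if q < length (d i) then \<Theta> q T else 0)" for T q
  have ch: "\<theta> \<in> koszul_chains (Suc p) (component i (e - 1))"
    using \<Theta> by (auto simp: koszul_chains_def \<theta>_def algebra_simps intro!: componentI)
  show thesis
  proof (rule that[OF ch])
    fix S
    show "vdiff \<theta> S = \<eta> S"
    proof (cases "card S = p")
      case True
      show ?thesis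
      proof
        fix q
        show "vdiff \<theta> S q = \<eta> S q"
          using \<Theta>(3)[OF _ True, of q] componentD(2)[OF component_chains[OF \<eta>], of q S]
          by (cases "q < length (d i)") (auto simp: vdiff_def \<theta>_def kdiff_def)
      qed
    next
      case False
      then show ?thesis using vdiff_chains_0[OF ch] chainsD(2)[OF \<eta>] by simp
    qed
  qed
qed

lemma vdiff_onto:
  assumes w: "w \<in> component i e" and const: "\<And>q. q < length (d i) \<Longrightarrow> Poly_Mapping.lookup (w q) 0 = 0"
  obtains \<theta> where "\<theta> \<in> koszul_chains 1 (component i (e - 1))" "vdiff \<theta> {} = w"
proof -
  have "\<exists>\<theta>. (\<forall>T. homogeneous (e - int (d i ! q) - 1) (\<theta> T)) \<and> (\<forall>T. card T \<noteq> 1 \<longrightarrow> \<theta> T = 0) \<and>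
      kdiff \<theta> {} = w q" if q: "q < length (d i)" for q
    by (rule kdiff_onto[OF componentD(1)[OF w q] const[OF q]]) auto
  then obtain \<Theta> where \<Theta>: "\<And>q T. q < length (d i) \<Longrightarrow> homogeneous (e - int (d i ! q) - 1) (\<Theta> q T)"
    "\<And>q T. q < length (d i) \<Longrightarrow> card T \<noteq> 1 \<Longrightarrow> \<Theta> q T = 0"
    "\<And>q. q < length (d i) \<Longrightarrow> kdiff (\<Theta> q) {} = w q" by metis
  define \<theta> where "\<theta> T q = (if q < length (d i) then \<Theta> q T else 0)" for T q
  have "\<theta> \<in> koszul_chains 1 (component i (e - 1))"
    using \<Theta> by (auto simp: koszul_chains_def \<theta>_def algebra_simps intro!: componentI)
  moreover have "vdiff \<theta> {} = w"
  proof
    fix q show "vdiff \<theta> {} q = w q"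
      using \<Theta>(3)[of q] componentD(2)[OF w, of q]
      by (cases "q < length (d i)") (auto simp: vdiff_def \<theta>_def kdiff_def)
  qed
  ultimately show thesis using that by blast
qed

lemma app_no_constant: "Poly_Mapping.lookup (app i w q) 0 = 0"
proof (cases "q < length (d i)")
  case True
  have "Poly_Mapping.lookup (D i $$ (q, r) * w r) 0 = 0" if "r < length (d (Suc i))" for r
  proof (rule ccontr)
    assume "Poly_Mapping.lookup (D i $$ (q, r) * w r) 0 \<noteq> 0"
    then have "0 \<in> Poly_Mapping.keys (D i $$ (q, r) * w r)" by (simp add: in_keys_iff)
    then obtain a b where ab: "0 = a + b" "a \<in> Poly_Mapping.keys (D i $$ (q, r))"
      using keys_mult[of "D i $$ (q, r)" "w r"] by blast
    have "Poly_Mapping.keys a = {}" using keys_add_nat[of a b] ab(1) by simp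
    then show False using D_no_constant[OF True that] ab(2) by (simp add: in_keys_iff)
  qed
  then show ?thesis using True by (simp add: app_def lookup_sum)
qed (simp add: app_def)

text \<open>
  For \<open>p > 0\<close>, this is the vanishing of \<open>Tor\<^sub>p\<close> of the cokernel of \<open>D i\<close> with the residue field, in
  internal degree \<open>p + e\<close>. Stating it by lifting boundaries avoids quotient modules.
\<close>

definition koszul_exact_at :: "nat \<Rightarrow> nat \<Rightarrow> int \<Rightarrow> bool" where
  "koszul_exact_at i p e \<longleftrightarrow>
     (\<forall>\<eta>\<in>koszul_chains p (component i e).
        (\<forall>S. Suc (card S) = p \<longrightarrow> vdiff \<eta> S \<in> app i ` component (Suc i) (e + 1)) \<longrightarrow>
        (\<exists>\<eta>'\<in>koszul_chains p (app i ` component (Suc i) e). \<forall>S. vdiff \<eta>' S = vdiff \<eta> S))"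

text \<open>F_i is free, so Tor_(p+1) of M_i is Tor_p of M_(i+1); the internal degree (p + 1) + (e -
  1) = p + e is kept. The proof is the diagram chase for the connecting map.\<close>

lemma koszul_exact_at_Suc:
  assumes p: "p > 0" and ex: "koszul_exact_at i (Suc p) (e - 1)"
  shows "koszul_exact_at (Suc i) p e"
  unfolding koszul_exact_at_def
proof (intro ballI impI)
  fix \<eta> assume \<eta>: "\<eta> \<in> koszul_chains p (component (Suc i) e)"
    and bd: "\<forall>S. Suc (card S) = p \<longrightarrow> vdiff \<eta> S \<in> app (Suc i) ` component (Suc (Suc i)) (e + 1)"
  have D\<eta>: "(\<lambda>S. app i (\<eta> S)) \<in> koszul_chains p (component i e)"
    using \<eta> by (auto simp: koszul_chains_def app_component)
  \<comment> \<open>\<open>app i\<close> kills the image of \<open>app (Suc i)\<close>, so a cycle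
    modulo that image becomes a true cycle with values in a free module.\<close>
  have "vdiff (\<lambda>S. app i (\<eta> S)) S = (\<lambda>_. 0)" if "Suc (card S) = p" for S
    using bd that app_app by (auto simp flip: app_vdiff)
  then obtain \<theta> where \<theta>: "\<theta> \<in> koszul_chains (Suc p) (component i (e - 1))" "\<And>S. vdiff \<theta> S = app i (\<eta> S)"
    using vdiff_exact[OF p D\<eta>] by blast
  have "\<forall>S. Suc (card S) = Suc p \<longrightarrow> vdiff \<theta> S \<in> app i ` component (Suc i) (e - 1 + 1)"
    using component_chains[OF \<eta>] by (simp add: \<theta>(2))
  then obtain \<theta>' where \<theta>': "\<theta>' \<in> koszul_chains (Suc p) (app i ` component (Suc i) (e - 1))"
    "\<And>S. vdiff \<theta>' S = vdiff \<theta> S"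
    using ex \<theta>(1) unfolding koszul_exact_at_def by blast
  obtain \<xi> where \<xi>: "\<xi> \<in> koszul_chains (Suc p) (component (Suc i) (e - 1))" "\<And>S. app i (\<xi> S) = \<theta>' S"
    using chains_choose[OF \<theta>'(1)] by auto
  \<comment> \<open>Subtracting a boundary keeps \<open>vdiff\<close> and moves the chain into the
    kernel of \<open>app i\<close>, which is the image of the next map.\<close>
  let ?\<eta> = "\<lambda>S q. \<eta> S q - vdiff \<xi> S q"
  have "?\<eta> S \<in> component (Suc i) e" for S
    by (intro component_minus component_chains[OF \<eta>] component_vdiff[OF \<xi>(1)])
  moreover have "app i (?\<eta> S) = (\<lambda>_. 0)" for S
    unfolding app_minus app_vdiff \<xi>(2) \<theta>'(2) \<theta>(2) by simp
  ultimately have "?\<eta> S \<in> app (Suc i) ` component (Suc (Suc i)) e" for S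
    by (rule kernel_app)
  moreover have "?\<eta> S = (\<lambda>_. 0)" if "card S \<noteq> p" for S
    using that chainsD(2)[OF \<eta>] vdiff_chains_0[OF \<xi>(1)] by simp
  ultimately have "?\<eta> \<in> koszul_chains p (app (Suc i) ` component (Suc (Suc i)) e)"
    by (simp add: koszul_chains_def)
  moreover have "vdiff ?\<eta> S = vdiff \<eta> S" for S
    unfolding vdiff_minus vdiff_vdiff by simp
  ultimately show "\<exists>\<eta>'\<in>koszul_chains p (app (Suc i) ` component (Suc (Suc i)) e). \<forall>S. vdiff \<eta>' S = vdiff \<eta> S"
    by blast
qed

text \<open>The converse chase, which brings a vanishing Betti number down to R/I.\<close>

lemma koszul_exact_at_pred:
  assumes p: "p > 0" and ex: "koszul_exact_at (Suc i) p e"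
  shows "koszul_exact_at i (Suc p) (e - 1)"
  unfolding koszul_exact_at_def
proof (intro ballI impI)
  fix \<theta> assume \<theta>: "\<theta> \<in> koszul_chains (Suc p) (component i (e - 1))"
    and bd: "\<forall>S. Suc (card S) = Suc p \<longrightarrow> vdiff \<theta> S \<in> app i ` component (Suc i) (e - 1 + 1)"
  have "vdiff \<theta> \<in> koszul_chains p (app i ` component (Suc i) e)"
    using bd vdiff_chains_0[OF \<theta>] by (simp add: koszul_chains_def)
  then obtain \<eta> where \<eta>: "\<eta> \<in> koszul_chains p (component (Suc i) e)" "\<And>S. app i (\<eta> S) = vdiff \<theta> S"
    using chains_choose by (metis app_0)
  have "vdiff \<eta> S \<in> component (Suc i) (e + 1)" for S
    using component_vdiff[of \<eta> p "Suc i" "e + 1"] \<eta>(1) by simp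
  moreover have "app i (vdiff \<eta> S) = (\<lambda>_. 0)" for S
    unfolding app_vdiff \<eta>(2) by (rule vdiff_vdiff)
  ultimately have "vdiff \<eta> S \<in> app (Suc i) ` component (Suc (Suc i)) (e + 1)" for S
    by (rule kernel_app)
  then obtain \<eta>' where \<eta>': "\<eta>' \<in> koszul_chains p (app (Suc i) ` component (Suc (Suc i)) e)"
    "\<And>S. vdiff \<eta>' S = vdiff \<eta> S"
    using ex \<eta>(1) unfolding koszul_exact_at_def by blast
  \<comment> \<open>A true cycle, hence the boundary of some \<open>\<xi>\<close>; applying
    \<open>app i\<close> removes \<open>\<eta>'\<close> and recovers the boundary of
    \<open>\<theta>\<close>.\<close>
  let ?\<eta> = "\<lambda>S q. \<eta> S q - \<eta>' S q"
  have \<eta>'_app: "\<eta>' S \<in> range (app (Suc i))" for S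
    using chainsD[OF \<eta>'(1), of S] by (cases "card S = p") (auto intro: range_eqI[of _ _ "\<lambda>_. 0"])
  have "\<eta>' S \<in> component (Suc i) e" for S
    using chainsD[OF \<eta>'(1), of S] by (cases "card S = p") (auto simp: app_component)
  then have "?\<eta> \<in> koszul_chains p (component (Suc i) e)"
    using component_minus component_chains[OF \<eta>(1)] chainsD(2)[OF \<eta>(1)] chainsD(2)[OF \<eta>'(1)]
    by (simp add: koszul_chains_def)
  moreover have "vdiff ?\<eta> S = (\<lambda>_. 0)" for S unfolding vdiff_minus \<eta>'(2) by simp
  ultimately obtain \<xi> where \<xi>: "\<xi> \<in> koszul_chains (Suc p) (component (Suc i) (e - 1))" "\<And>S. vdiff \<xi> S = ?\<eta> S"
    using vdiff_exact[OF p] by blast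
  have "(\<lambda>S. app i (\<xi> S)) \<in> koszul_chains (Suc p) (app i ` component (Suc i) (e - 1))"
    using \<xi>(1) by (auto simp: koszul_chains_def)
  moreover have "vdiff (\<lambda>S. app i (\<xi> S)) S = vdiff \<theta> S" for S
    using \<eta>'_app[of S] by (auto simp: app_minus app_app \<xi>(2) \<eta>(2) simp flip: app_vdiff)
  ultimately show "\<exists>\<eta>'\<in>koszul_chains (Suc p) (app i ` component (Suc i) (e - 1)). \<forall>S. vdiff \<eta>' S = vdiff \<theta> S"
    by (intro bexI[of _ "\<lambda>S. app i (\<xi> S)"]) auto
qed

text \<open>By minimality Tor_1 of M_i is F_(i+1) modulo the variables, so its degree
  \<open>j\<close> part is spanned by the basis elements of degree \<open>j\<close>.\<close>

lemma koszul_exact_at_1_iff: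
  assumes "int j = e + 1"
  shows "koszul_exact_at i 1 e \<longleftrightarrow> j \<notin> set (d (Suc i))"
proof
  assume j: "j \<notin> set (d (Suc i))"
  show "koszul_exact_at i 1 e"
    unfolding koszul_exact_at_def
  proof (intro ballI impI)
    fix \<eta> assume \<eta>: "\<eta> \<in> koszul_chains 1 (component i e)"
      and "\<forall>S. Suc (card S) = 1 \<longrightarrow> vdiff \<eta> S \<in> app i ` component (Suc i) (e + 1)"
    then have "vdiff \<eta> {} \<in> app i ` component (Suc i) (e + 1)" by simp
    then obtain w where w: "w \<in> component (Suc i) (e + 1)" "vdiff \<eta> {} = app i w" by blast
    \<comment> \<open>A constant term could only sit at a basis element of degree
      \<open>e + 1 = j\<close>.\<close>
    have "Poly_Mapping.lookup (w q) 0 = 0" if q: "q < length (d (Suc i))" for q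
    proof (rule lookup_homogeneous[OF componentD(1)[OF w(1) q]])
      have "d (Suc i) ! q \<noteq> j" using q j by auto
      then show "int (monom_degree (0 :: 'v \<Rightarrow>\<^sub>0 nat)) \<noteq> e + 1 - int (d (Suc i) ! q)"
        using assms by (simp add: monom_degree_def)
    qed
    then obtain \<omega> where \<omega>: "\<omega> \<in> koszul_chains 1 (component (Suc i) e)" "vdiff \<omega> {} = w"
      using vdiff_onto[OF w(1)] by auto
    have "(\<lambda>S. app i (\<omega> S)) \<in> koszul_chains 1 (app i ` component (Suc i) e)"
      using \<omega>(1) by (auto simp: koszul_chains_def)
    moreover have "vdiff (\<lambda>S. app i (\<omega> S)) S = vdiff \<eta> S" for S
    proof (cases "S = {}")
      case True
      then show ?thesis by (simp add: w(2) \<omega>(2) flip: app_vdiff)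
    next
      case False
      then have "Suc (card S) \<noteq> 1" by simp
      then show ?thesis
        using vdiff_chains_0[OF \<eta>] vdiff_chains_0[OF \<omega>(1)] by (simp flip: app_vdiff)
    qed
    ultimately show "\<exists>\<eta>'\<in>koszul_chains 1 (app i ` component (Suc i) e). \<forall>S. vdiff \<eta>' S = vdiff \<eta> S"
      by (intro bexI[of _ "\<lambda>S. app i (\<omega> S)"]) auto
  qed
next
  assume ex: "koszul_exact_at i 1 e"
  show "j \<notin> set (d (Suc i))"
  proof
    assume "j \<in> set (d (Suc i))"
    then obtain q where q: "q < length (d (Suc i))" "d (Suc i) ! q = j" by (auto simp: in_set_conv_nth)
    \<comment> \<open>A basis vector of degree \<open>j\<close>. Minimality makes its image a
      boundary; exactness then places \<open>w\<close>, up to a boundary, in the image of the next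
      map. Vectors there have no constant terms, but \<open>w\<close> has the entry 1.\<close>
    define w :: "('v, 'k) mpolys" where "w r = (if r = q then 1 else 0)" for r
    have w: "w \<in> component (Suc i) (e + 1)"
      using q assms by (intro componentI) (auto simp: w_def homogeneous_def monom_degree_def)
    obtain \<eta> where \<eta>: "\<eta> \<in> koszul_chains 1 (component i e)" "vdiff \<eta> {} = app i w"
      using vdiff_onto[OF app_component[OF w]] app_no_constant by auto
    have "\<forall>S. Suc (card S) = 1 \<longrightarrow> vdiff \<eta> S \<in> app i ` component (Suc i) (e + 1)"
      using \<eta>(2) w by auto
    then obtain \<eta>' where \<eta>': "\<eta>' \<in> koszul_chains 1 (app i ` component (Suc i) e)"
      "vdiff \<eta>' {} = app i w"
      using ex \<eta> unfolding koszul_exact_at_def by metis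
    obtain \<xi> where \<xi>: "\<xi> \<in> koszul_chains 1 (component (Suc i) e)" "\<And>S. app i (\<xi> S) = \<eta>' S"
      using chains_choose[OF \<eta>'(1)] by auto
    let ?w = "\<lambda>q. w q - vdiff \<xi> {} q"
    have "?w \<in> component (Suc i) (e + 1)"
      using component_vdiff[of \<xi> 1 "Suc i" "e + 1"] \<xi>(1) by (intro component_minus w) simp
    moreover have "app i ?w = (\<lambda>_. 0)"
      unfolding app_minus app_vdiff \<xi>(2) \<eta>'(2) by simp
    ultimately obtain u where "?w = app (Suc i) u" using kernel_app by blast
    then have "Poly_Mapping.lookup (?w q) 0 = 0" using app_no_constant[of "Suc i" u q] by metis
    then show False by (simp add: w_def lookup_minus vdiff_def)
  qed
qed

lemma koszul_exact_at_shift: "koszul_exact_at 0 (Suc i) e \<Longrightarrow> koszul_exact_at i 1 (e + int i)"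
proof -
  assume 0: "koszul_exact_at 0 (Suc i) e"
  \<comment> \<open>The two arguments always add up to the internal degree
    \<open>Suc i + e\<close>.\<close>
  have "koszul_exact_at j (Suc i - j) (e + int j)" if "j \<le> i" for j
    using that
  proof (induction j)
    case (Suc j)
    have "koszul_exact_at (Suc j) (i - j) (e + int j + 1)"
      using Suc by (intro koszul_exact_at_Suc) (simp_all add: Suc_diff_le)
    then show ?case using Suc.prems by (simp add: algebra_simps)
  qed (simp add: 0)
  from this[of i] show ?thesis by simp
qed

lemma component_0_iff: "w \<in> component 0 e \<longleftrightarrow> homogeneous e (w 0) \<and> (\<forall>q>0. w q = 0)"
  by (auto simp: component_def d_0)

end

theorem theorem4p8:
  fixes E :: "'v::finite set set"
    and \<beta> :: "nat \<Rightarrow> nat \<Rightarrow> nat"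
    and k :: nat
    and a :: "nat \<Rightarrow> nat"
  assumes "simple_graph E" and "E \<noteq> {}"
    and "graded_betti_numbers (edge_ideal E :: ('v, 'k::field_char_0) mpoly set) \<beta>"
    and "has_jump_sequence \<beta> k a"
    and "k \<ge> 3"
    and "a 1 = 2"
  shows "a 2 \<ge> 5"
proof -
  obtain d D where res: "minimal_graded_free_resolution (edge_ideal E :: ('v, 'k) mpoly set) d D"
    and \<beta>: "\<And>i j. \<beta> i j = count_list (d i) j"
    using assms(3) unfolding graded_betti_numbers_def by blast
  interpret minimal_resolution "edge_ideal E :: ('v, 'k) mpoly set" d D
    by (rule minimal_resolution.intro[OF res])
  have E: "simple_graph E" by fact
  have \<beta>0: "\<beta> i j = 0 \<longleftrightarrow> j \<notin> set (d i)" for i j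
    by (simp add: \<beta> count_list_0_iff)
  have jump: "(\<exists>i. \<beta> i (i + r + 1) \<noteq> 0) \<and> a r = (LEAST i. \<beta> i (i + r + 1) \<noteq> 0) - 1" if "r \<in> {1..k - 1}" for r
    using assms(4) that unfolding has_jump_sequence_def by blast
  have "a 1 = (LEAST i. \<beta> i (i + 1 + 1) \<noteq> 0) - 1" using jump[of 1] assms(5) by simp
  \<comment> \<open>The truncated predecessor of the least index is 2, so that index is 3 and b(2,
    4) = 0.\<close>
  then have "2 < (LEAST i. \<beta> i (i + 1 + 1) \<noteq> 0)" using assms(6) by simp
  from not_less_Least[OF this] have "4 \<notin> set (d 2)" by (simp add: \<beta>0)
  \<comment> \<open>b(2, 4) counts columns of \<open>D 1\<close>. Its internal degree is 4 = 1 + 3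
    at this stage and 4 = 2 + 2 over R/I.\<close>
  then have "koszul_exact_at 1 1 3" by (subst koszul_exact_at_1_iff[of 4]) (simp_all add: numeral_2_eq_2)
  then have ex: "koszul_exact_at 0 2 2"
    using koszul_exact_at_pred[of 1 0 3] by (simp add: numeral_2_eq_2)
  have gf: "gap_free E"
  proof (rule gap_free_if_koszul[OF E])
    fix \<eta> :: "'v set \<Rightarrow> ('v, 'k) mpoly"
    assume \<eta>: "\<And>S. homogeneous 2 (\<eta> S)" "\<And>S. card S \<noteq> 2 \<Longrightarrow> \<eta> S = 0"
      "\<And>S. card S = 1 \<Longrightarrow> kdiff \<eta> S \<in> edge_ideal E"
    \<comment> \<open>F_0 has rank 1, so a polynomial becomes a vector with its only entry at index
      0.\<close>
    let ?\<eta> = "\<lambda>S q. if q = (0 :: nat) then \<eta> S else 0"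
    have vd: "vdiff ?\<eta> S = (\<lambda>q. if q = 0 then kdiff \<eta> S else 0)" for S
      by (rule ext) (simp add: vdiff_def kdiff_def)
    have "?\<eta> \<in> koszul_chains 2 (component 0 2)"
      using \<eta> by (auto simp: koszul_chains_def component_0_iff)
    moreover have "vdiff ?\<eta> S \<in> app 0 ` component (Suc 0) (2 + 1)" if "Suc (card S) = 2" for S
      unfolding image_app_0_iff component_0_iff vd using \<eta> that by (auto intro: homogeneous_kdiff)
    ultimately obtain \<eta>' where \<eta>': "\<eta>' \<in> koszul_chains 2 (app 0 ` component (Suc 0) 2)"
      "\<And>S. vdiff \<eta>' S = vdiff ?\<eta> S"
      using ex unfolding koszul_exact_at_def by blast
    have "\<eta>' S \<in> app 0 ` component (Suc 0) 2" for S
    proof (cases "card S = 2")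
      case False
      then have eq: "\<eta>' S = app 0 (\<lambda>_. 0)" using chainsD(2)[OF \<eta>'(1)] by simp
      show ?thesis unfolding eq by (rule imageI) (rule component_0)
    qed (rule chainsD(1)[OF \<eta>'(1)])
    then have "homogeneous 2 (\<eta>' S 0) \<and> \<eta>' S 0 \<in> edge_ideal E" for S
      unfolding image_app_0_iff component_0_iff by blast
    moreover have "kdiff (\<lambda>S. \<eta>' S 0) S = kdiff \<eta> S" for S
      using fun_cong[OF \<eta>'(2)[of S], of 0] unfolding vd by (simp add: vdiff_def)
    ultimately show "\<exists>\<eta>'. (\<forall>S. homogeneous 2 (\<eta>' S)) \<and> (\<forall>S. \<eta>' S \<in> edge_ideal E) \<and>
        (\<forall>S. card S = 1 \<longrightarrow> kdiff \<eta>' S = kdiff \<eta> S)"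
      by (intro exI[of _ "\<lambda>S. \<eta>' S 0"]) blast
  qed
  \<comment> \<open>Internal degree p + 3, that is b(p, p + 3) as seen over R/I.\<close>
  have ex3: "koszul_exact_at 0 p 3" if p: "0 < p" "p \<le> 5" for p
    unfolding koszul_exact_at_def
  proof (intro ballI impI)
    fix \<eta> assume \<eta>: "\<eta> \<in> koszul_chains p (component 0 3)"
      and bd: "\<forall>S. Suc (card S) = p \<longrightarrow> vdiff \<eta> S \<in> app 0 ` component (Suc 0) (3 + 1)"
    have \<eta>0: "homogeneous 3 (\<eta> S 0)" "q > 0 \<Longrightarrow> \<eta> S q = 0" for S q
      using component_chains[OF \<eta>, of S] by (simp_all add: component_0_iff)
    obtain \<zeta> where \<zeta>: "\<And>S. homogeneous 3 (\<zeta> S)" "\<And>S. card S \<noteq> p \<Longrightarrow> \<zeta> S = 0"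
      "\<And>S. \<zeta> S \<in> edge_ideal E" "\<And>S. kdiff \<zeta> S = kdiff (\<lambda>S. \<eta> S 0) S"
    proof (rule edge_ideal_koszul[OF E gf p, of "\<lambda>S. \<eta> S 0"])
      fix S :: "'v set"
      show "\<eta> S 0 = 0" if "card S \<noteq> p" using chainsD(2)[OF \<eta> that] by simp
      show "kdiff (\<lambda>S. \<eta> S 0) S \<in> edge_ideal E" if "Suc (card S) = p"
        using bd that unfolding image_app_0_iff by (simp add: vdiff_def)
    qed (auto simp: \<eta>0)
    let ?\<eta> = "\<lambda>S q. if q = (0 :: nat) then \<zeta> S else 0"
    have "?\<eta> S \<in> app 0 ` component (Suc 0) 3" for S
      unfolding image_app_0_iff component_0_iff using \<zeta> by simp
    moreover have "?\<eta> S = (\<lambda>_. 0)" if "card S \<noteq> p" for S using \<zeta>(2)[OF that] by auto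
    ultimately have "?\<eta> \<in> koszul_chains p (app 0 ` component (Suc 0) 3)" by (simp add: koszul_chains_def)
    moreover have "vdiff ?\<eta> S = vdiff \<eta> S" for S
    proof
      fix q show "vdiff ?\<eta> S q = vdiff \<eta> S q"
        using \<zeta>(4)[of S] \<eta>0(2) by (cases "q = 0") (simp_all add: vdiff_def kdiff_def)
    qed
    ultimately show "\<exists>\<eta>'\<in>koszul_chains p (app 0 ` component (Suc 0) 3). \<forall>S. vdiff \<eta>' S = vdiff \<eta> S" by blast
  qed
  have van: "\<beta> i (i + 3) = 0" if "i \<le> 5" for i
  proof (cases i)
    case 0
    then show ?thesis by (simp add: \<beta>0 d_0)
  next
    case (Suc j)
    \<comment> \<open>Homological degree \<open>Suc j\<close> over R/I becomes degree 1 over the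
      cokernel of \<open>D j\<close>, in the same internal degree \<open>Suc j + 3\<close>.\<close>
    have "koszul_exact_at j 1 (3 + int j)" using that Suc by (intro koszul_exact_at_shift ex3) auto
    then show ?thesis unfolding \<beta>0 Suc by (subst (asm) koszul_exact_at_1_iff[of "Suc j + 3"]) auto
  qed
  define L where "L = (LEAST i. \<beta> i (i + 2 + 1) \<noteq> 0)"
  have ex2: "\<exists>i. \<beta> i (i + 2 + 1) \<noteq> 0" and a2: "a 2 = L - 1"
    using jump[of 2] assms(5) unfolding L_def by auto
  have "\<beta> L (L + 2 + 1) \<noteq> 0"
    unfolding L_def by (rule LeastI_ex[of "\<lambda>i. \<beta> i (i + 2 + 1) \<noteq> 0", OF ex2])
  then have "\<beta> L (L + 3) \<noteq> 0" by (simp add: numeral_3_eq_3)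
  \<comment> \<open>The least index is thus at least 6, and \<open>a 2\<close> is one less.\<close>
  then have "\<not> L \<le> 5" using van[of L] by (cases "L \<le> 5") simp_all
  then show ?thesis using a2 by linarith
qed

end
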